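(* Let $r_{\max}$ and $r_{\min}$ denote the maximum and minimum values of a reward program $\hat r$. The optimal reward program $\hat r^*_{SC}$ under the spread constraint, i.e. the solution of $$\underset{\hat r:\mathbb{R}\to[0,p],\ c\in\mathbb{R}}{\text{maximize}}\ \ \mathbb{E}_v\Big[(p-\hat r(v))\,\Phi\Big(\frac{v-c}{\sigma_\epsilon}\Big)\Big]\quad\text{subject to}\quad r_{\max}-r_{\min}\le\sqrt{2\pi}\,\frac{\sigma_\epsilon\sigma}{\sigma_\theta},\qquad c+\mathbb{E}_{v|v_i=c}[\hat r(v)]=p,$$ is of the form $$\hat r^*_{SC}(v)=r_M\times\mathbf{1}\{v\le v_c\},\qquad r_M=\min\Big(p,\sqrt{2\pi}\,\frac{\sigma_\epsilon\sigma}{\sigma_\theta}\Big),$$ where $(c,v_c)$ is the solution of $$p=c+r_M\,\Phi\Big(\frac{v_c-\mu_c}{\sigma_v}\Big),\qquad \frac{\Phi\big(\frac{v_c-c}{\sigma_\epsilon}\big)}{\frac{1}{\sigma_\epsilon}\phi\big(\frac{v_c-c}{\sigma_\epsilon}\big)}=\frac{c}{1-\tau r_M\,\frac{1}{\sigma_v}\phi\big(\frac{v_c-\mu_c}{\sigma_v}\big)},$$ with $\mu_c=\tau c+(1-\tau)\theta$.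
   Context: Parameters: $\theta\in\mathbb{R}$, $\sigma_\theta>0$, $\sigma_\epsilon>0$, $\sigma=\sqrt{\sigma_\theta^2+\sigma_\epsilon^2}$. $\Phi$ and $\phi$ are the CDF and PDF of the standard normal distribution. The quality $v$ of a product has prior $v\sim N(\theta,\sigma_\theta^2)$; $\mathbb{E}_v$ is expectation under this prior. Consumers have valuations $v_i=v+\epsilon_i$ with $\epsilon_i\sim N(0,\sigma_\epsilon^2)$ independent of $v$, so that $v\,|\,v_i\sim N(\tau v_i+(1-\tau)\theta,\sigma_v^2)$ with $\tau=\frac{\sigma_\theta^2}{\sigma_\epsilon^2+\sigma_\theta^2}$ and $\sigma_v=\frac{\sigma_\epsilon\sigma_\theta}{\sqrt{\sigma_\epsilon^2+\sigma_\theta^2}}$; $\mathbb{E}_{v|v_i}$ is expectation under this posterior. Standing assumption: the market price $p>0$ maximizes $p\mapsto p\,\Phi(\frac{\theta-p}{\sigma})$, i.e. it is the unique solution of $\frac{p}{\sigma}=\Phi(\frac{\theta-p}{\sigma})/\phi(\frac{\theta-p}{\sigma})$. Reward programs are measurable functions $\hat r:\mathbb{R}\to[0,p]$; $\hat r(v)$ is the rebate paid to each buyer when the realized quality is $v$. The number $c$ is the cutoff of the consumers' purchase strategy (buy iff $v_i>c$), the equation $c+\mathbb{E}_{v|v_i=c}[\hat r(v)]=p$ says that a consumer with valuation $c$ is indifferent, and the objective is the seller's expected profit. Functions agreeing almost everywhere are identified.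
   Formalization: The system can have several solutions, so uniqueness is not claimed: a maximum exists, every optimal program has the stated form a.e. with its cutoff c and some v_c solving the system, and a solution of the system is shown optimal when it is the only one. *)

theory Defs
  imports "HOL-Probability.Probability"
begin

abbreviation std_cdf :: "real \<Rightarrow> real"  (\<open>\<Phi>\<close>)
  where "\<Phi> \<equiv> cdf std_normal_distribution"

abbreviation std_pdf :: "real \<Rightarrow> real"  (\<open>\<phi>\<close>)
  where "\<phi> \<equiv> std_normal_density"

definition normal_measure :: "real \<Rightarrow> real \<Rightarrow> real measure"
  where "normal_measure \<mu> s = density lborel (\<lambda>x. ennreal (normal_density \<mu> s x))"

text \<open>
  Throughout, \<open>\<theta>\<close> and \<open>s\<^sub>\<theta>\<close> are the mean and standard deviation of the prior on the quality \<open>v\<close>,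
  and \<open>s\<^sub>\<epsilon>\<close> is the standard deviation of the idiosyncratic noise in the valuation \<open>v + \<epsilon>\<close>.
\<close>

definition valuation_sd :: "real \<Rightarrow> real \<Rightarrow> real"
  where "valuation_sd s\<^sub>\<theta> s\<^sub>\<epsilon> = sqrt (s\<^sub>\<theta>\<^sup>2 + s\<^sub>\<epsilon>\<^sup>2)"

definition signal_weight :: "real \<Rightarrow> real \<Rightarrow> real"
  where "signal_weight s\<^sub>\<theta> s\<^sub>\<epsilon> = s\<^sub>\<theta>\<^sup>2 / (s\<^sub>\<epsilon>\<^sup>2 + s\<^sub>\<theta>\<^sup>2)"

definition posterior_sd :: "real \<Rightarrow> real \<Rightarrow> real"
  where "posterior_sd s\<^sub>\<theta> s\<^sub>\<epsilon> = s\<^sub>\<epsilon> * s\<^sub>\<theta> / sqrt (s\<^sub>\<epsilon>\<^sup>2 + s\<^sub>\<theta>\<^sup>2)"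

definition posterior_mean :: "real \<Rightarrow> real \<Rightarrow> real \<Rightarrow> real \<Rightarrow> real"
  where "posterior_mean \<theta> s\<^sub>\<theta> s\<^sub>\<epsilon> x =
    signal_weight s\<^sub>\<theta> s\<^sub>\<epsilon> * x + (1 - signal_weight s\<^sub>\<theta> s\<^sub>\<epsilon>) * \<theta>"

definition prior :: "real \<Rightarrow> real \<Rightarrow> real measure"
  where "prior \<theta> s\<^sub>\<theta> = normal_measure \<theta> s\<^sub>\<theta>"

text \<open>The conditional law of the quality given that the valuation equals \<open>x\<close>.\<close>

definition posterior :: "real \<Rightarrow> real \<Rightarrow> real \<Rightarrow> real \<Rightarrow> real measure"
  where "posterior \<theta> s\<^sub>\<theta> s\<^sub>\<epsilon> x =
    normal_measure (posterior_mean \<theta> s\<^sub>\<theta> s\<^sub>\<epsilon> x) (posterior_sd s\<^sub>\<theta> s\<^sub>\<epsilon>)"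

text \<open>For \<open>q \<le> 0\<close> the revenue is nonpositive, so restricting to positive prices loses nothing.\<close>

definition optimal_price :: "real \<Rightarrow> real \<Rightarrow> real \<Rightarrow> real \<Rightarrow> bool"
  where "optimal_price \<theta> s\<^sub>\<theta> s\<^sub>\<epsilon> p \<longleftrightarrow> p > 0 \<and>
    (\<forall>q>0. q * \<Phi> ((\<theta> - q) / valuation_sd s\<^sub>\<theta> s\<^sub>\<epsilon>) \<le> p * \<Phi> ((\<theta> - p) / valuation_sd s\<^sub>\<theta> s\<^sub>\<epsilon>))"

definition reward_program :: "real \<Rightarrow> (real \<Rightarrow> real) \<Rightarrow> bool"
  where "reward_program p r \<longleftrightarrow> r \<in> borel_measurable borel \<and> (\<forall>v. 0 \<le> r v \<and> r v \<le> p)"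

text \<open>
  A measurable function need not attain its extrema, so the maximum and minimum are read as
  supremum and infimum. Every program agrees almost everywhere with one whose supremum and infimum
  are its essential ones, so up to null sets a bound on this spread is a bound on the essential
  spread.
\<close>

definition spread :: "(real \<Rightarrow> real) \<Rightarrow> real"
  where "spread r = (SUP v. r v) - (INF v. r v)"

definition spread_bound :: "real \<Rightarrow> real \<Rightarrow> real"
  where "spread_bound s\<^sub>\<theta> s\<^sub>\<epsilon> = sqrt (2 * pi) * (s\<^sub>\<epsilon> * valuation_sd s\<^sub>\<theta> s\<^sub>\<epsilon> / s\<^sub>\<theta>)"

definition profit :: "real \<Rightarrow> real \<Rightarrow> real \<Rightarrow> real \<Rightarrow> (real \<Rightarrow> real) \<Rightarrow> real \<Rightarrow> real"
  where "profit \<theta> s\<^sub>\<theta> s\<^sub>\<epsilon> p r c = (\<integral>v. (p - r v) * \<Phi> ((v - c) / s\<^sub>\<epsilon>) \<partial>prior \<theta> s\<^sub>\<theta>)"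

definition SC_feasible :: "real \<Rightarrow> real \<Rightarrow> real \<Rightarrow> real \<Rightarrow> (real \<Rightarrow> real) \<Rightarrow> real \<Rightarrow> bool"
  where "SC_feasible \<theta> s\<^sub>\<theta> s\<^sub>\<epsilon> p r c \<longleftrightarrow>
    reward_program p r \<and>
    spread r \<le> spread_bound s\<^sub>\<theta> s\<^sub>\<epsilon> \<and>
    c + (\<integral>v. r v \<partial>posterior \<theta> s\<^sub>\<theta> s\<^sub>\<epsilon> c) = p"

definition SC_optimal :: "real \<Rightarrow> real \<Rightarrow> real \<Rightarrow> real \<Rightarrow> (real \<Rightarrow> real) \<Rightarrow> real \<Rightarrow> bool"
  where "SC_optimal \<theta> s\<^sub>\<theta> s\<^sub>\<epsilon> p r c \<longleftrightarrow>
    SC_feasible \<theta> s\<^sub>\<theta> s\<^sub>\<epsilon> p r c \<and>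
    (\<forall>r' c'. SC_feasible \<theta> s\<^sub>\<theta> s\<^sub>\<epsilon> p r' c' \<longrightarrow>
      profit \<theta> s\<^sub>\<theta> s\<^sub>\<epsilon> p r' c' \<le> profit \<theta> s\<^sub>\<theta> s\<^sub>\<epsilon> p r c)"

definition SC_reward :: "real \<Rightarrow> real \<Rightarrow> real \<Rightarrow> real"
  where "SC_reward s\<^sub>\<theta> s\<^sub>\<epsilon> p = min p (spread_bound s\<^sub>\<theta> s\<^sub>\<epsilon>)"

definition threshold_program :: "real \<Rightarrow> real \<Rightarrow> real \<Rightarrow> real"
  where "threshold_program b t v = b * indicator {..t} v"

text \<open>
  The denominator on the right of the second equation vanishes exactly when the reward equals the
  spread bound and \<open>t\<close> is the posterior mean. In that case the right-hand side is \<open>c / 0 = 0\<close>,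
  whereas the left-hand side is positive; hence no solution is created by this convention.
\<close>

definition SC_system :: "real \<Rightarrow> real \<Rightarrow> real \<Rightarrow> real \<Rightarrow> real \<Rightarrow> real \<Rightarrow> bool"
  where "SC_system \<theta> s\<^sub>\<theta> s\<^sub>\<epsilon> p c t \<longleftrightarrow>
    p = c + SC_reward s\<^sub>\<theta> s\<^sub>\<epsilon> p *
          \<Phi> ((t - posterior_mean \<theta> s\<^sub>\<theta> s\<^sub>\<epsilon> c) / posterior_sd s\<^sub>\<theta> s\<^sub>\<epsilon>) \<and>
    \<Phi> ((t - c) / s\<^sub>\<epsilon>) / (1 / s\<^sub>\<epsilon> * \<phi> ((t - c) / s\<^sub>\<epsilon>)) =
      c / (1 - signal_weight s\<^sub>\<theta> s\<^sub>\<epsilon> * SC_reward s\<^sub>\<theta> s\<^sub>\<epsilon> p *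
             (1 / posterior_sd s\<^sub>\<theta> s\<^sub>\<epsilon> *
               \<phi> ((t - posterior_mean \<theta> s\<^sub>\<theta> s\<^sub>\<epsilon> c) / posterior_sd s\<^sub>\<theta> s\<^sub>\<epsilon>)))"

end

theory Submission
  imports Defs
begin

text \<open>
  A program with values in \<open>[m, m + w]\<close> amounts to the price \<open>p - m\<close> together with a program with
  values in \<open>[0, w]\<close>. For a fixed cutoff \<open>c\<close> a Neyman--Pearson argument shows that it is dominated
  by \<open>m + w * indicator {..t}\<close> for the \<open>t\<close> that keeps the consumer with valuation \<open>c\<close> indifferent.
  Raising the effective price \<open>q = p - m\<close> while the posterior quantile of the threshold stays fixed
  raises the profit as long as \<open>q < p\<close>: by a bathtub argument the loss from the marginal consumers
  is smaller than the gain, because the optimality of \<open>p\<close> makes \<open>q\<close> smaller than the inverse hazard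
  rate of the valuation at \<open>q\<close>; the spread constraint keeps the weights of the bathtub argument below
  \<open>1\<close>. So \<open>m = 0\<close>, and there remains a maximisation over the posterior quantile of the threshold.
  The profit increases at \<open>-\<infinity>\<close>, starting from the profit without rewards, and decreases at
  \<open>\<infinity>\<close>, so a maximum exists, and the first-order condition there is the second equation of the
  system.
\<close>

subsection \<open>The normal distribution\<close>

lemma DERIV_integral_atMost:
  fixes g :: "real \<Rightarrow> real"
  assumes g: "integrable lborel g" and cont: "continuous_on UNIV g"
  shows "((\<lambda>t. \<integral>x. indicator {..t} x * g x \<partial>lborel) has_real_derivative g t) (at t)"
proof -
  \<comment> \<open>The auxiliary end point \<open>a < t\<close> splits off a part that does not
    depend on \<open>u\<close>, so the fundamental theorem of calculus is needed only on a compact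
    interval with \<open>t\<close> in its interior.\<close>
  define a where "a = t - 1"
  have split: "(\<integral>x. indicator {..u} x * g x \<partial>lborel) =
      (\<integral>x. indicator {..a} x * g x \<partial>lborel) + (LBINT y=a..u. g y)" if "a \<le> u" for u
  proof -
    have "(LBINT y=a..u. g y) = (\<integral>x. indicator {a<..u} x * g x \<partial>lborel)"
      using that by (simp add: interval_lebesgue_integral_def set_lebesgue_integral_def
          interval_integral_Ioc einterval_def flip: real_scaleR_def)
        (intro Bochner_Integration.integral_cong_AE, use g in measurable,
         use AE_lborel_singleton[of u] in \<open>auto elim!: eventually_mono split: split_indicator\<close>)
    moreover have "indicator {..u} x * g x = indicator {..a} x * g x + indicator {a<..u} x * g x" for x
      using that by (auto split: split_indicator)
    moreover have "integrable lborel (\<lambda>x. indicator B x * g x)" if "B \<in> sets borel" for B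
      using integrable_mult_indicator[OF _ g, of B] that by simp
    ultimately show ?thesis by simp
  qed
  have "((\<lambda>u. LBINT y=a..u. g y) has_vector_derivative g t) (at t within {a..t+1})"
    by (rule interval_integral_FTC2) (auto simp: a_def intro: continuous_on_subset[OF cont])
  then have "((\<lambda>u. LBINT y=a..u. g y) has_real_derivative g t) (at t)"
    by (simp add: has_real_derivative_iff_has_vector_derivative a_def
        at_within_interior[of t "{t-1..t+1}"])
  then have "((\<lambda>u. (\<integral>x. indicator {..a} x * g x \<partial>lborel) + (LBINT y=a..u. g y))
      has_real_derivative g t) (at t)"
    by (auto intro!: derivative_eq_intros)
  then show ?thesis
  proof (rule has_field_derivative_transform_within_open[where S="{a<..}"])
    show "(\<integral>x. indicator {..a} x * g x \<partial>lborel) + (LBINT y=a..u. g y) =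
        (\<integral>x. indicator {..u} x * g x \<partial>lborel)" if "u \<in> {a<..}" for u
      using split[of u] that by simp
  qed (auto simp: a_def)
qed

lemma integrable_indicator_mult:
  fixes g :: "real \<Rightarrow> real"
  assumes "integrable lborel g" "B \<in> sets borel"
  shows "integrable lborel (\<lambda>x. indicator B x * g x)"
  using integrable_mult_indicator[OF _ assms(1), of B] assms(2) by simp

lemma integrable_bounded_mult:
  fixes f g :: "real \<Rightarrow> real"
  assumes [measurable]: "f \<in> borel_measurable borel" and g: "integrable lborel g"
    and bound: "\<And>x. \<bar>f x\<bar> \<le> B"
  shows "integrable lborel (\<lambda>x. f x * g x)"
proof (rule Bochner_Integration.integrable_bound[OF integrable_mult_right[OF g, of B]])
  have [measurable]: "g \<in> borel_measurable borel"
    using borel_measurable_integrable[OF g] by simp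
  show "(\<lambda>x. f x * g x) \<in> borel_measurable lborel" by measurable
  show "AE x in lborel. norm (f x * g x) \<le> norm (B * g x)"
    using bound order_trans[OF bound abs_ge_self] by (auto simp: abs_mult intro!: mult_right_mono)
qed

lemma integral_greaterThan_eq:
  fixes g :: "real \<Rightarrow> real"
  assumes g: "integrable lborel g"
  shows "(\<integral>x. indicator {c<..} x * g x \<partial>lborel) =
    (\<integral>x. g x \<partial>lborel) - (\<integral>x. indicator {..c} x * g x \<partial>lborel)"
proof -
  have "(\<integral>x. g x \<partial>lborel) = (\<integral>x. indicator {c<..} x * g x + indicator {..c} x * g x \<partial>lborel)"
    by (intro Bochner_Integration.integral_cong) (auto split: split_indicator)
  then show ?thesis
    by (simp add: integrable_indicator_mult[OF g])
qed

lemma DERIV_integral_greaterThan: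
  fixes g :: "real \<Rightarrow> real"
  assumes g: "integrable lborel g" and cont: "continuous_on UNIV g"
  shows "((\<lambda>c. \<integral>x. indicator {c<..} x * g x \<partial>lborel) has_real_derivative - g c) (at c)"
  unfolding integral_greaterThan_eq[OF g]
  by (auto intro!: derivative_eq_intros DERIV_integral_atMost[OF g cont])

section \<open>Normal densities and the standard normal distribution function\<close>

lemma continuous_on_normal_density [continuous_intros]:
  assumes "continuous_on A f" "continuous_on A g"
  shows "continuous_on A (\<lambda>x. normal_density (f x) s (g x))"
  unfolding normal_density_def by (cases "s = 0") (auto intro!: continuous_intros assms)

lemma normal_density_std:
  assumes "s > 0"
  shows "normal_density \<mu> s x = \<phi> ((x - \<mu>) / s) / s"
  using assms by (simp add: normal_density_def real_sqrt_mult power_divide)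

lemma normal_density_swap: "normal_density \<mu> s x = normal_density x s \<mu>"
  by (simp add: normal_density_def power2_commute)

lemma std_pdf_minus [simp]: "\<phi> (- x) = \<phi> x"
  by (simp add: normal_density_def)

lemma std_pdf_pos [simp]: "\<phi> x > 0"
  by (simp add: normal_density_pos)

lemma std_pdf_nonzero [simp]: "\<phi> x \<noteq> 0"
  using std_pdf_pos[of x] by (metis less_irrefl)

lemma std_pdf_mono:
  assumes "\<bar>x\<bar> \<le> \<bar>y\<bar>"
  shows "\<phi> y \<le> \<phi> x"
proof -
  have "x\<^sup>2 \<le> y\<^sup>2" using assms by (simp add: abs_le_square_iff)
  then show ?thesis by (simp add: std_normal_density_def divide_right_mono)
qed

lemma DERIV_std_pdf [derivative_intros]:
  assumes "(f has_real_derivative f') (at x)"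
  shows "((\<lambda>x. \<phi> (f x)) has_real_derivative - f x * \<phi> (f x) * f') (at x)"
  unfolding std_normal_density_def
  by (rule derivative_eq_intros assms refl | simp)+

interpretation std: real_distribution std_normal_distribution
  by (rule real_dist_normal_dist)

lemma std_cdf_eq_integral: "\<Phi> x = (\<integral>u. indicator {..x} u * \<phi> u \<partial>lborel)"
proof -
  have "emeasure std_normal_distribution {..x} = (\<integral>\<^sup>+u. ennreal (indicator {..x} u * \<phi> u) \<partial>lborel)"
    by (subst emeasure_density) (auto intro!: nn_integral_cong split: split_indicator)
  also have "\<dots> = ennreal (\<integral>u. indicator {..x} u * \<phi> u \<partial>lborel)"
    by (intro nn_integral_eq_integral integrable_indicator_mult) auto
  finally show ?thesis
    unfolding cdf_def measure_def by (simp add: enn2real_ennreal Bochner_Integration.integral_nonneg)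
qed

lemma DERIV_std_cdf [derivative_intros]:
  assumes "(f has_real_derivative f') (at x)"
  shows "((\<lambda>x. \<Phi> (f x)) has_real_derivative \<phi> (f x) * f') (at x)"
proof -
  have "(\<Phi> has_real_derivative \<phi> y) (at y)" for y
    using DERIV_integral_atMost[of "\<phi>" y]
    by (simp add: std_cdf_eq_integral[abs_def] continuous_on_normal_density)
  from DERIV_chain2[OF this assms] show ?thesis .
qed

lemma std_cdf_strict_mono: "x < y \<Longrightarrow> \<Phi> x < \<Phi> y"
  by (rule DERIV_pos_imp_increasing) (auto intro!: exI derivative_eq_intros)

lemma std_cdf_mono: "x \<le> y \<Longrightarrow> \<Phi> x \<le> \<Phi> y"
  using std_cdf_strict_mono[of x y] by (cases "x = y") auto

lemma std_cdf_pos [simp]: "0 < \<Phi> x"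
  using std_cdf_strict_mono[of "x - 1" x] std.cdf_nonneg[of "x - 1"] by linarith

lemma std_cdf_less_1 [simp]: "\<Phi> x < 1"
  using std_cdf_strict_mono[of x "x + 1"] std.cdf_bounded_prob[of "x + 1"] by linarith

lemma continuous_on_std_cdf [continuous_intros]:
  assumes "continuous_on A f"
  shows "continuous_on A (\<lambda>x. \<Phi> (f x))"
proof -
  have "isCont \<Phi> y" for y
    by (rule DERIV_isCont, rule DERIV_std_cdf, rule DERIV_ident)
  then have "continuous_on UNIV \<Phi>" by (simp add: continuous_at_imp_continuous_on)
  from continuous_on_compose2[OF this assms] show ?thesis by simp
qed

lemma borel_measurable_std_cdf [measurable]: "\<Phi> \<in> borel_measurable borel"
  by (intro borel_measurable_continuous_onI continuous_intros)

lemma integral_normal_density_atMost: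
  assumes "s > 0"
  shows "(\<integral>x. indicator {..t} x * normal_density \<mu> s x \<partial>lborel) = \<Phi> ((t - \<mu>) / s)"
proof -
  have "\<mu> + s * x \<le> t \<longleftrightarrow> x \<le> (t - \<mu>) / s" for x
    using assms by (auto simp: pos_le_divide_eq mult.commute)
  then have eq: "s * (indicator {..t} (\<mu> + s * x) * normal_density \<mu> s (\<mu> + s * x)) =
      indicator {..(t - \<mu>) / s} x * \<phi> x" for x
    using assms by (simp add: normal_density_std[of s \<mu>] indicator_def)
  show ?thesis
    using assms
    by (subst lborel_integral_real_affine[where c=s and t=\<mu>])
      (simp_all add: std_cdf_eq_integral eq flip: integral_mult_right_zero)
qed

text \<open>Substituting \<open>\<mu> - s * x\<close> for \<open>x\<close> reflects the upper tail
  into a lower one; the open end point matters only on a null set.\<close>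

lemma integral_normal_density_greaterThan:
  assumes "s > 0"
  shows "(\<integral>x. indicator {c<..} x * normal_density \<mu> s x \<partial>lborel) = \<Phi> ((\<mu> - c) / s)"
proof -
  have "c < \<mu> - s * x \<longleftrightarrow> x < (\<mu> - c) / s" for x
    using assms by (auto simp: pos_less_divide_eq mult.commute)
  then have eq: "s * (indicator {c<..} (\<mu> - s * x) * normal_density \<mu> s (\<mu> - s * x)) =
      indicator {..<(\<mu> - c) / s} x * \<phi> x" for x
    using assms by (simp add: normal_density_std[of s \<mu>] indicator_def)
  have "(\<integral>x. indicator {c<..} x * normal_density \<mu> s x \<partial>lborel) =
      (\<integral>x. indicator {..<(\<mu> - c) / s} x * \<phi> x \<partial>lborel)"
    using assms
    by (subst lborel_integral_real_affine[where c="-s" and t=\<mu>])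
      (simp_all add: eq flip: integral_mult_right_zero)
  also have "\<dots> = \<Phi> ((\<mu> - c) / s)"
    unfolding std_cdf_eq_integral
    by (intro Bochner_Integration.integral_cong_AE)
      (use AE_lborel_singleton[of "(\<mu> - c) / s"] in \<open>auto elim!: eventually_mono split: split_indicator\<close>)
  finally show ?thesis .
qed

lemma std_cdf_minus: "\<Phi> (- x) = 1 - \<Phi> x"
  using integral_greaterThan_eq[of "\<phi>" x] integral_normal_density_greaterThan[of 1 x 0]
  by (simp add: std_cdf_eq_integral)

lemma std_cdf_zero: "\<Phi> 0 = 1 / 2"
  using std_cdf_minus[of 0] by simp

lemma std_cdf_surj:
  assumes "0 < u" "u < 1"
  obtains x where "\<Phi> x = u"
proof -
  obtain a where a: "\<Phi> a < u"
    using order_tendstoD(2)[OF std.cdf_lim_at_bot assms(1)]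
    by (auto simp: eventually_at_bot_linorder)
  obtain b where b: "u < \<Phi> b"
    using order_tendstoD(1)[OF std.cdf_lim_at_top_prob assms(2)]
    by (auto simp: eventually_at_top_linorder)
  have "a \<le> b" using a b std_cdf_mono[of b a] by linarith
  moreover have "continuous_on {a..b} \<Phi>" by (intro continuous_intros)
  ultimately show thesis
    using IVT'[of \<Phi> a u b] a b that by force
qed

text \<open>For negative \<open>x\<close>, the function \<open>n\<close> is strictly decreasing on
  the negative axis and lies below \<open>\<Phi>\<close>, which tends to 0 at minus infinity. Hence
  \<open>n\<close> is negative, and multiplying by \<open>x\<close> gives the claim.\<close>

lemma mills_pos: "0 < \<phi> x + x * \<Phi> x"
proof (cases "x < 0")
  case True
  define n where "n = (\<lambda>y. \<Phi> y + \<phi> y / y)"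
  have n_mono: "n b < n a" if "a < b" "b < 0" for a b
    unfolding n_def
  proof (rule DERIV_neg_imp_decreasing[OF that(1)])
    fix y assume "a \<le> y" "y \<le> b"
    then have "y < 0" using that by linarith
    then have "((\<lambda>y. \<Phi> y + \<phi> y / y) has_real_derivative - \<phi> y / y\<^sup>2) (at y)"
      by (auto intro!: derivative_eq_intros simp: field_simps power2_eq_square)
    then show "\<exists>d. ((\<lambda>y. \<Phi> y + \<phi> y / y) has_real_derivative d) (at y) \<and> d < 0"
      using \<open>y < 0\<close> by (auto simp: divide_neg_pos)
  qed
  have le: "n y \<le> \<Phi> y" if "y < 0" for y
    using that by (simp add: n_def divide_nonneg_neg)
  have "\<forall>\<^sub>F y in at_bot. n (x - 1) \<le> \<Phi> y"
    using eventually_gt_at_bot[of "x - 1"]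
  proof eventually_elim
    case (elim y)
    then show ?case using n_mono[of y "x - 1"] le[of y] True by linarith
  qed
  then have "n (x - 1) \<le> 0"
    by (rule tendsto_lowerbound[OF std.cdf_lim_at_bot]) simp
  then have "n x < 0" using n_mono[of "x - 1" x] True by linarith
  then show ?thesis using True by (simp add: n_def field_simps)
qed (auto intro!: add_pos_nonneg mult_nonneg_nonneg less_imp_le[OF std_cdf_pos])

subsection \<open>The ratio of the normal distribution function to the density\<close>

text \<open>The classical Mills ratio reflected at zero: the upper tail at \<open>- x\<close>
  divided by the density there. With scale \<open>\<sigma>\<close> and argument
  \<open>(\<theta> - q) / \<sigma>\<close> it gives the inverse hazard rate of the valuation at
  \<open>q\<close>.\<close>

definition mills_ratio :: "real \<Rightarrow> real"
  where "mills_ratio x = \<Phi> x / \<phi> x"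

lemma mills_ratio_pos [simp]: "0 < mills_ratio x"
  by (simp add: mills_ratio_def)

lemma mills_ratio_mult_pdf: "mills_ratio x * \<phi> x = \<Phi> x"
  by (simp add: mills_ratio_def)

text \<open>This is \<open>mills_pos\<close> divided by the density. The quantity is the derivative
  of \<open>mills_ratio\<close>, so the ratio increases; for negative \<open>x\<close> it also
  bounds the ratio by \<open>- 1 / x\<close>.\<close>

lemma mills_ratio_deriv_pos: "0 < 1 + x * mills_ratio x"
proof -
  have "1 + x * mills_ratio x = (\<phi> x + x * \<Phi> x) / \<phi> x"
    by (simp add: mills_ratio_def add_divide_distrib)
  then show ?thesis using mills_pos[of x] by simp
qed

lemma DERIV_mills_ratio [derivative_intros]:
  assumes "(f has_real_derivative f') (at x)"
  shows "((\<lambda>x. mills_ratio (f x)) has_real_derivative (1 + f x * mills_ratio (f x)) * f') (at x)"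
proof -
  have "((\<lambda>x. \<Phi> x / \<phi> x) has_real_derivative (1 + y * mills_ratio y)) (at y)" for y
  proof -
    have "((\<lambda>x. \<Phi> x / \<phi> x) has_real_derivative
        (\<phi> y * 1 * \<phi> y - \<Phi> y * (- y * \<phi> y * 1)) / (\<phi> y * \<phi> y)) (at y)"
      by (intro derivative_intros) auto
    moreover have "(\<phi> y * 1 * \<phi> y - \<Phi> y * (- y * \<phi> y * 1)) / (\<phi> y * \<phi> y) = 1 + y * mills_ratio y"
      by (simp add: mills_ratio_def divide_simps) (simp add: algebra_simps)
    ultimately show ?thesis by simp
  qed
  then have "(mills_ratio has_real_derivative (1 + y * mills_ratio y)) (at y)" for y
    by (simp add: mills_ratio_def[abs_def])
  from DERIV_chain2[OF this assms] show ?thesis .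
qed

lemma mills_ratio_strict_mono: "x < y \<Longrightarrow> mills_ratio x < mills_ratio y"
  by (rule DERIV_pos_imp_increasing, assumption)
    (use DERIV_mills_ratio[OF DERIV_ident] mills_ratio_deriv_pos in auto)

lemma mills_ratio_mono: "x \<le> y \<Longrightarrow> mills_ratio x \<le> mills_ratio y"
  using mills_ratio_strict_mono[of x y] by (cases "x = y") auto

lemma mills_ratio_neg_less: "x < 0 \<Longrightarrow> mills_ratio x < - 1 / x"
  using mills_ratio_deriv_pos[of x] by (simp add: field_simps)

lemma mills_ratio_minus_id_mono:
  assumes "0 \<le> x" "x \<le> y"
  shows "mills_ratio x - x \<le> mills_ratio y - y"
proof (rule DERIV_nonneg_imp_nondecreasing[OF assms(2)])
  fix z assume "x \<le> z"
  then have "0 \<le> z * mills_ratio z" using assms by (simp add: less_imp_le)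
  moreover have "((\<lambda>z. mills_ratio z - z) has_real_derivative z * mills_ratio z) (at z)"
    by (auto intro!: derivative_eq_intros)
  ultimately show "\<exists>d. ((\<lambda>z. mills_ratio z - z) has_real_derivative d) (at z) \<and> 0 \<le> d"
    by blast
qed

lemma mills_ratio_ge_id:
  assumes "0 \<le> x"
  shows "x \<le> mills_ratio x"
  using mills_ratio_minus_id_mono[of 0 x] mills_ratio_pos[of 0] assms by linarith

text \<open>The left-hand side is the mass of the interval of length \<open>u\<close> centred at 0,
  which is at most its length times the peak density.\<close>

lemma std_cdf_central_le:
  assumes "0 \<le> u"
  shows "2 * \<Phi> (u / 2) - 1 \<le> u * \<phi> 0"
proof -
  have "0 * \<phi> 0 - 2 * \<Phi> (0 / 2) \<le> u * \<phi> 0 - 2 * \<Phi> (u / 2)"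
  proof (rule DERIV_nonneg_imp_nondecreasing[OF assms])
    fix x :: real
    have "((\<lambda>u. u * \<phi> 0 - 2 * \<Phi> (u / 2)) has_real_derivative \<phi> 0 - \<phi> (x / 2)) (at x)"
      by (auto intro!: derivative_eq_intros)
    then show "\<exists>d. ((\<lambda>u. u * \<phi> 0 - 2 * \<Phi> (u / 2)) has_real_derivative d) (at x) \<and> 0 \<le> d"
      using std_pdf_mono[of 0 "x / 2"] by force
  qed
  then show ?thesis by (simp add: std_cdf_zero)
qed

text \<open>The density decreases from \<open>u\<close> to \<open>b + u\<close>, so the mass in
  between is at least the length \<open>b\<close> times the density at the right end. The proof
  differentiates in \<open>b\<close>.\<close>

lemma std_cdf_minus_pdf_ge:
  assumes "0 \<le> b" "0 \<le> u"
  shows "\<Phi> u \<le> \<Phi> (b + u) - b * \<phi> (b + u)"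
proof -
  have "\<Phi> (0 + u) - 0 * \<phi> (0 + u) \<le> \<Phi> (b + u) - b * \<phi> (b + u)"
  proof (rule DERIV_nonneg_imp_nondecreasing[OF assms(1)])
    fix x :: real assume "0 \<le> x"
    have "((\<lambda>b. \<Phi> (b + u) - b * \<phi> (b + u)) has_real_derivative x * (x + u) * \<phi> (x + u)) (at x)"
      by (auto intro!: derivative_eq_intros simp: algebra_simps)
    then show "\<exists>d. ((\<lambda>b. \<Phi> (b + u) - b * \<phi> (b + u)) has_real_derivative d) (at x) \<and> 0 \<le> d"
      using \<open>0 \<le> x\<close> assms by (intro exI[of _ "x * (x + u) * \<phi> (x + u)"] conjI) auto
  qed
  then show ?thesis by simp
qed

text \<open>
  The difference \<open>E b\<close> of the two sides has derivative \<open>u * \<phi> (b + u) * (mills_ratio b - b - u)\<close>, so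
  on \<open>{0..}\<close> it is smallest at \<open>0\<close> or where \<open>mills_ratio b = b + u\<close>.
\<close>

lemma std_cdf_bathtub_aux:
  assumes "0 \<le> b" "0 \<le> u"
  shows "(mills_ratio b - u) * \<phi> (b + u) + (2 * \<Phi> (u / 2) - 1) \<le> \<Phi> (b + u)"
proof -
  define E where "E = (\<lambda>b. \<Phi> (b + u) - (mills_ratio b - u) * \<phi> (b + u) - (2 * \<Phi> (u / 2) - 1))"
  \<comment> \<open>Here the factor \<open>mills_ratio x - u\<close> can be replaced by
    \<open>x\<close>, and the central mass is at most \<open>\<Phi> u\<close> because
    \<open>2 * \<Phi> (u / 2) - 1 \<le> \<Phi> (u / 2)\<close>.\<close>
  have direct: "0 \<le> E x" if "0 \<le> x" "mills_ratio x \<le> x + u" for x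
  proof -
    have "(mills_ratio x - u) * \<phi> (x + u) \<le> x * \<phi> (x + u)"
      using that by (intro mult_right_mono) auto
    moreover have "\<Phi> (u / 2) \<le> \<Phi> u" using assms by (intro std_cdf_mono) auto
    ultimately show ?thesis
      using std_cdf_minus_pdf_ge[OF that(1) assms(2)] std_cdf_less_1[of "u / 2"]
      unfolding E_def by linarith
  qed
  have E_mono: "E x \<le> E y" if "0 \<le> x" "x \<le> y" "x + u \<le> mills_ratio x" for x y
  proof (rule DERIV_nonneg_imp_nondecreasing[OF that(2)])
    fix z assume z: "x \<le> z"
    have "z + u \<le> mills_ratio z"
      using mills_ratio_minus_id_mono[OF that(1) z] that(3) by linarith
    then have "0 \<le> u * \<phi> (z + u) * (mills_ratio z - z - u)"
      using assms by (intro mult_nonneg_nonneg) auto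
    moreover have "(E has_real_derivative u * \<phi> (z + u) * (mills_ratio z - z - u)) (at z)"
      unfolding E_def by (auto intro!: derivative_eq_intros simp: algebra_simps)
    ultimately show "\<exists>d. (E has_real_derivative d) (at z) \<and> 0 \<le> d" by blast
  qed
  have "0 \<le> E b"
  proof (cases "mills_ratio b \<le> b + u")
    case False
    show ?thesis
    proof (cases "u \<le> mills_ratio 0")
      case True
      \<comment> \<open>Now \<open>E\<close> is nondecreasing from 0 on, so \<open>E 0\<close>
        decides. In terms of \<open>e\<close> and \<open>y = u * \<phi> 0\<close>, the two preceding
        lemmas bound it below by \<open>1 / 2 - y - e * (1 / 2 - 2 * y)\<close>.\<close>
      define e where "e = \<phi> u / \<phi> 0"
      have e: "0 \<le> e" "e \<le> 1" "\<phi> u = e * \<phi> 0"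
        using std_pdf_mono[of 0 u] std_pdf_pos[of 0] by (auto simp: e_def)
      define y where "y = u * \<phi> 0"
      have half: "mills_ratio 0 * \<phi> 0 = 1 / 2"
        by (simp add: mills_ratio_mult_pdf std_cdf_zero)
      have y: "0 \<le> y" "y \<le> 1 / 2"
        using assms mult_right_mono[OF True, of "\<phi> 0"] half by (auto simp: y_def)
      have "e * (1 / 2 - 2 * y) \<le> 1 / 2 - y"
      proof (cases "2 * y \<le> 1 / 2")
        case True
        then have "e * (1 / 2 - 2 * y) \<le> 1 / 2 - 2 * y"
          using e by (intro mult_left_le_one_le) auto
        also have "\<dots> \<le> 1 / 2 - y" using y by simp
        finally show ?thesis .
      next
        case False
        then have "e * (1 / 2 - 2 * y) \<le> 0"
          using e by (intro mult_nonneg_nonpos) auto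
        also have "0 \<le> 1 / 2 - y" using y by simp
        finally show ?thesis .
      qed
      moreover have "1 / 2 + u * \<phi> u \<le> \<Phi> u"
        using std_cdf_minus_pdf_ge[of u 0] assms by (simp add: std_cdf_zero)
      moreover have "mills_ratio 0 * \<phi> u = e / 2" "u * \<phi> u = e * y"
        using half by (simp_all add: e(3) y_def mult.left_commute)
      ultimately have "0 \<le> E 0"
        using std_cdf_central_le[OF assms(2)]
        unfolding E_def y_def[symmetric] by (simp add: algebra_simps)
      also have "E 0 \<le> E b"
        using True assms by (intro E_mono) auto
      finally show ?thesis .
    next
      case F0: False
      \<comment> \<open>Between 0 and \<open>b\<close> the difference
        \<open>mills_ratio x - x\<close> crosses \<open>u\<close>. At the crossing
        \<open>direct\<close> applies, and from there \<open>E_mono\<close> carries the sign to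
        \<open>b\<close>.\<close>
      have "continuous_on {0..b} (\<lambda>x. mills_ratio x - x)"
      proof (rule DERIV_continuous_on, rule has_field_derivative_at_within)
        show "((\<lambda>x. mills_ratio x - x) has_real_derivative x * mills_ratio x) (at x)" for x
          by (auto intro!: derivative_eq_intros)
      qed
      then obtain x where "0 \<le> x" "x \<le> b" "mills_ratio x - x = u"
        using IVT'[of "\<lambda>x. mills_ratio x - x" 0 u b] False F0 assms by auto
      then show ?thesis using direct[of x] E_mono[of x b] by linarith
    qed
  qed (use direct assms in auto)
  then show ?thesis by (simp add: E_def)
qed

subsection \<open>The bathtub inequality\<close>

text \<open>
  A bathtub argument: among the weights \<open>0 \<le> f \<le> 1\<close> of given mass, the integral against the bell
  curve is largest for the indicator of an interval centred at \<open>\<theta>\<close>.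
\<close>

lemma normal_bathtub:
  fixes f :: "real \<Rightarrow> real" and \<theta> \<sigma> c q :: real
  assumes "\<sigma> > 0" and f [measurable]: "integrable lborel f"
    and f01: "\<And>x. 0 \<le> f x" "\<And>x. f x \<le> 1"
    and mass: "(\<integral>x. indicator {c<..} x * f x \<partial>lborel) = q - c"
    and "0 \<le> c" and q: "q < \<sigma> * mills_ratio ((\<theta> - q) / \<sigma>)"
  shows "c * normal_density \<theta> \<sigma> c + (\<integral>x. indicator {c<..} x * (f x * normal_density \<theta> \<sigma> x) \<partial>lborel)
    < \<Phi> ((\<theta> - c) / \<sigma>)"
proof -
  let ?d = "normal_density \<theta> \<sigma>"
  let ?I = "\<integral>x. indicator {c<..} x * (f x * ?d x) \<partial>lborel"
  have d_eq: "?d x = \<phi> ((\<theta> - x) / \<sigma>) / \<sigma>" for x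
    using normal_density_std[OF \<open>\<sigma> > 0\<close>, of x \<theta>] by (simp only: normal_density_swap[of \<theta>])
  have d_mono: "?d y \<le> ?d x" if "\<bar>x - \<theta>\<bar> \<le> \<bar>y - \<theta>\<bar>" for x y
    unfolding d_eq using that \<open>\<sigma> > 0\<close>
    by (intro divide_right_mono std_pdf_mono) (auto simp: divide_right_mono abs_minus_commute)
  have d_le: "?d x \<le> ?d \<theta>" for x by (rule d_mono) simp
  have d_pos: "?d x > 0" for x using \<open>\<sigma> > 0\<close> by (rule normal_density_pos)
  have [measurable]: "f \<in> borel_measurable borel"
    using borel_measurable_integrable[OF f] by simp
  have int_d: "integrable lborel ?d"
    using \<open>\<sigma> > 0\<close> by simp
  have int_fd: "integrable lborel (\<lambda>x. f x * ?d x)"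
  proof (rule Bochner_Integration.integrable_bound[OF int_d])
    show "AE x in lborel. norm (f x * ?d x) \<le> norm (?d x)"
      using f01 d_pos by (auto simp: abs_mult intro!: mult_left_le_one_le)
  qed measurable
  have "c \<le> q"
  proof -
    have "0 \<le> (\<integral>x. indicator {c<..} x * f x \<partial>lborel)"
      using f01 by (intro Bochner_Integration.integral_nonneg) auto
    then show ?thesis using mass by simp
  qed
  have I_le: "?I \<le> (q - c) * l" if l: "\<And>x. c < x \<Longrightarrow> ?d x \<le> l" for l
  proof -
    have "?I \<le> (\<integral>x. (indicator {c<..} x * f x) * l \<partial>lborel)"
      using f01 l by (intro integral_mono integrable_mult_left integrable_indicator_mult f int_fd)
        (auto intro!: mult_left_mono split: split_indicator)
    also have "\<dots> = (q - c) * l"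
      unfolding integral_mult_left_zero mass ..
    finally show ?thesis .
  qed
  have hazard: "\<Phi> ((\<theta> - x) / \<sigma>) = \<sigma> * mills_ratio ((\<theta> - x) / \<sigma>) * ?d x" for x
    using \<open>\<sigma> > 0\<close> by (simp add: d_eq mills_ratio_mult_pdf)
  \<comment> \<open>In the first two cases it suffices to bound the density by its value at
    \<open>c\<close> or by its peak at \<open>\<theta>\<close>. In the third the interval of length
    \<open>q - c\<close> centred at \<open>\<theta>\<close> lies to the right of \<open>c\<close>,
    and the sharper bathtub bound is used.\<close>
  consider "\<theta> \<le> c" | "c < \<theta>" "\<theta> < q" | "c < \<theta>" "q \<le> \<theta>" by linarith
  then show ?thesis
  proof cases
    case 1
    have "c * ?d c + ?I \<le> c * ?d c + (q - c) * ?d c"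
      using 1 by (intro add_left_mono I_le d_mono) auto
    also have "\<dots> = q * ?d c" by (simp add: algebra_simps)
    also have "\<dots> < \<sigma> * mills_ratio ((\<theta> - q) / \<sigma>) * ?d c"
      using q d_pos by (rule mult_strict_right_mono)
    also have "\<dots> \<le> \<sigma> * mills_ratio ((\<theta> - c) / \<sigma>) * ?d c"
      using \<open>\<sigma> > 0\<close> \<open>c \<le> q\<close> d_pos[of c]
      by (intro mult_right_mono mult_left_mono mills_ratio_mono divide_right_mono) auto
    finally show ?thesis unfolding hazard .
  next
    case 2
    have "c * ?d c + ?I \<le> c * ?d \<theta> + (q - c) * ?d \<theta>"
      using \<open>0 \<le> c\<close> d_le by (intro add_mono mult_left_mono I_le) auto
    also have "\<dots> = q * ?d \<theta>" by (simp add: algebra_simps)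
    also have "\<dots> < \<sigma> * mills_ratio ((\<theta> - q) / \<sigma>) * ?d \<theta>"
      using q d_pos by (rule mult_strict_right_mono)
    also have "\<dots> \<le> \<sigma> * mills_ratio ((\<theta> - \<theta>) / \<sigma>) * ?d \<theta>"
      using \<open>\<sigma> > 0\<close> \<open>\<theta> < q\<close> d_pos[of \<theta>]
      by (intro mult_right_mono mult_left_mono mills_ratio_mono divide_right_mono) auto
    also have "\<dots> \<le> \<Phi> ((\<theta> - c) / \<sigma>)"
      unfolding hazard[symmetric] using 2 \<open>\<sigma> > 0\<close>
      by (intro std_cdf_mono divide_right_mono) auto
    finally show ?thesis .
  next
    case 3
    define u where "u = (q - c) / \<sigma>"
    define b where "b = (\<theta> - q) / \<sigma>"
    have bu: "0 \<le> b" "0 \<le> u" "b + u = (\<theta> - c) / \<sigma>"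
      using 3 \<open>c \<le> q\<close> \<open>\<sigma> > 0\<close> by (auto simp: b_def u_def add_divide_distrib[symmetric])
    define l r where "l = \<theta> - (q - c) / 2" and "r = \<theta> + (q - c) / 2"
    have lr: "c \<le> l" "l \<le> r" using 3 \<open>c \<le> q\<close> by (auto simp: l_def r_def field_simps)
    have abs_r: "\<bar>r - \<theta>\<bar> = (q - c) / 2" using \<open>c \<le> q\<close> by (simp add: r_def)
    \<comment> \<open>An exchange argument with multiplier \<open>?d r\<close>, the density at the
      ends of the centred interval: inside, the density is larger and \<open>f \<le> 1\<close>;
      outside, it is smaller and \<open>0 \<le> f\<close>. After integration the multiplier term
      vanishes, since the interval is as long as the mass of \<open>f\<close> beyond
      \<open>c\<close>.\<close>
    have pointwise: "indicator {c<..} x * (f x * ?d x) \<le>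
        indicator {l<..r} x * ?d x + ?d r * (indicator {c<..} x * f x - indicator {l<..r} x)" for x
    proof -
      have "f x * ?d x \<le> ?d x + ?d r * (f x - 1)" if "l < x" "x \<le> r"
      proof -
        have "\<bar>x - \<theta>\<bar> \<le> (q - c) / 2"
          using that unfolding l_def r_def by linarith
        then have "?d r \<le> ?d x" by (intro d_mono) (simp only: abs_r)
        then have "0 \<le> (1 - f x) * (?d x - ?d r)"
          using f01(2)[of x] by (intro mult_nonneg_nonneg) auto
        then show ?thesis by (simp add: algebra_simps)
      qed
      moreover have "f x * ?d x \<le> ?d r * f x" if "\<not> (l < x \<and> x \<le> r)"
      proof -
        have "(q - c) / 2 \<le> \<bar>x - \<theta>\<bar>"
          using that unfolding l_def r_def by linarith
        then have "?d x \<le> ?d r" by (intro d_mono) (simp only: abs_r)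
        then show ?thesis using f01(1)[of x] by (simp add: mult.commute mult_left_mono)
      qed
      ultimately show ?thesis using lr by (auto split: split_indicator)
    qed
    have int1: "integrable lborel (indicator {l<..r} :: real \<Rightarrow> real)"
      by (intro integrable_real_indicator) (auto simp: emeasure_lborel_Ioc lr)
    have "?I \<le> (\<integral>x. indicator {l<..r} x * ?d x + ?d r * (indicator {c<..} x * f x - indicator {l<..r} x) \<partial>lborel)"
      by (intro integral_mono pointwise integrable_indicator_mult int_fd Bochner_Integration.integrable_add
          int_d integrable_mult_right Bochner_Integration.integrable_diff f int1) auto
    also have "\<dots> = (\<integral>x. indicator {l<..r} x * ?d x \<partial>lborel) + ?d r * ((q - c) - (r - l))"
      using int1 f int_d lr by (simp add: integrable_indicator_mult mass)
    also have "r - l = q - c" by (simp add: l_def r_def)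
    also have "(\<integral>x. indicator {l<..r} x * ?d x \<partial>lborel) =
        (\<integral>x. indicator {..r} x * ?d x - indicator {..l} x * ?d x \<partial>lborel)"
      using lr by (intro Bochner_Integration.integral_cong) (auto split: split_indicator)
    also have "\<dots> = \<Phi> ((r - \<theta>) / \<sigma>) - \<Phi> ((l - \<theta>) / \<sigma>)"
      using int_d \<open>\<sigma> > 0\<close> by (simp add: integrable_indicator_mult integral_normal_density_atMost)
    also have "(r - \<theta>) / \<sigma> = u / 2" by (simp add: r_def u_def)
    also have "(l - \<theta>) / \<sigma> = - (u / 2)" by (simp add: l_def u_def)
    finally have I: "?I \<le> 2 * \<Phi> (u / 2) - 1"
      by (simp add: std_cdf_minus)
    have "c / \<sigma> < mills_ratio b - u"
      using q \<open>\<sigma> > 0\<close> by (simp add: u_def b_def field_simps)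
    then have "c / \<sigma> * \<phi> (b + u) < (mills_ratio b - u) * \<phi> (b + u)"
      by (intro mult_strict_right_mono) auto
    moreover have "c * ?d c = c / \<sigma> * \<phi> (b + u)" by (simp add: d_eq bu)
    ultimately show ?thesis
      using I std_cdf_bathtub_aux[OF bu(1,2)] by (simp add: bu(3))
  qed
qed

subsection \<open>Demand and the sales of low quality products\<close>

lemma integrable_std_cdf_mult:
  fixes f g :: "real \<Rightarrow> real"
  assumes [measurable]: "f \<in> borel_measurable borel" and g: "integrable lborel g"
  shows "integrable lborel (\<lambda>x. \<Phi> (f x) * g x)"
proof (rule integrable_bounded_mult[OF _ g])
  show "\<bar>\<Phi> (f x)\<bar> \<le> 1" for x
    using less_imp_le[OF std_cdf_less_1] by (simp add: std.cdf_nonneg)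
qed measurable

lemma integral_normal_measure:
  assumes "f \<in> borel_measurable borel"
  shows "(\<integral>x. f x \<partial>normal_measure m s) = (\<integral>x. f x * normal_density m s x \<partial>lborel)"
  unfolding normal_measure_def using assms
  by (subst integral_density) (auto simp: mult.commute)

text \<open>Completing the square in \<open>v\<close>, with \<open>a\<close> as prior variance and
  \<open>b\<close> as noise variance.\<close>

lemma gaussian_exponent_identity:
  fixes a b :: real
  assumes "a > 0" "b > 0"
  shows "(v - \<theta>)\<^sup>2 / a + (x - v)\<^sup>2 / b =
    (x - \<theta>)\<^sup>2 / (a + b) + (v - (a / (b + a) * x + (1 - a / (b + a)) * \<theta>))\<^sup>2 / (a * b / (a + b))"
proof -
  define s where "s = a + b"
  have s: "s > 0" using assms by (simp add: s_def)
  have b: "b = s - a" by (simp add: s_def)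
  have "a / s * x + (1 - a / s) * \<theta> = \<theta> + a * (x - \<theta>) / s"
    using s by (simp add: field_simps)
  then have "(v - (a / s * x + (1 - a / s) * \<theta>))\<^sup>2 / (a * b / s) =
      (s * (v - \<theta>) - a * (x - \<theta>))\<^sup>2 / (s * a * b)"
    using s assms by (simp add: power2_eq_square divide_simps) (simp add: algebra_simps)
  moreover have "(v - \<theta>)\<^sup>2 / a + (x - v)\<^sup>2 / b =
      (x - \<theta>)\<^sup>2 / s + (s * (v - \<theta>) - a * (x - \<theta>))\<^sup>2 / (s * a * b)"
    using s assms(1) \<open>b > 0\<close> unfolding b
    by (simp add: divide_simps) (simp add: algebra_simps power2_eq_square)
  ultimately show ?thesis by (simp add: s_def add.commute)
qed

section \<open>The model, its derived parameters and Bayes' rule\<close>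

locale reward_model =
  fixes \<theta> s\<^sub>\<theta> s\<^sub>\<epsilon> p :: real
  assumes prior_sd_pos: "s\<^sub>\<theta> > 0" and noise_sd_pos: "s\<^sub>\<epsilon> > 0"
    and price: "optimal_price \<theta> s\<^sub>\<theta> s\<^sub>\<epsilon> p"
begin

abbreviation \<sigma> :: real where "\<sigma> \<equiv> valuation_sd s\<^sub>\<theta> s\<^sub>\<epsilon>"
abbreviation \<tau> :: real where "\<tau> \<equiv> signal_weight s\<^sub>\<theta> s\<^sub>\<epsilon>"
abbreviation \<sigma>\<^sub>v :: real where "\<sigma>\<^sub>v \<equiv> posterior_sd s\<^sub>\<theta> s\<^sub>\<epsilon>"
abbreviation \<mu> :: "real \<Rightarrow> real" where "\<mu> \<equiv> posterior_mean \<theta> s\<^sub>\<theta> s\<^sub>\<epsilon>"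
abbreviation w :: real where "w \<equiv> SC_reward s\<^sub>\<theta> s\<^sub>\<epsilon> p"

text \<open>The density of the valuation, and the probability that it exceeds \<open>c\<close>.\<close>

abbreviation d :: "real \<Rightarrow> real" where "d \<equiv> normal_density \<theta> \<sigma>"
abbreviation D :: "real \<Rightarrow> real" where "D c \<equiv> \<Phi> ((\<theta> - c) / \<sigma>)"

lemma valuation_sd_pos: "\<sigma> > 0"
  using prior_sd_pos noise_sd_pos by (simp add: valuation_sd_def add_pos_pos)

lemma valuation_sd_sq: "\<sigma>\<^sup>2 = s\<^sub>\<theta>\<^sup>2 + s\<^sub>\<epsilon>\<^sup>2"
  by (simp add: valuation_sd_def)

lemma posterior_sd_eq: "\<sigma>\<^sub>v = s\<^sub>\<epsilon> * s\<^sub>\<theta> / \<sigma>"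
  by (simp add: posterior_sd_def valuation_sd_def add.commute)

lemma posterior_sd_pos: "\<sigma>\<^sub>v > 0"
  using valuation_sd_pos prior_sd_pos noise_sd_pos by (simp add: posterior_sd_eq)

lemma signal_weight_eq: "\<tau> = s\<^sub>\<theta>\<^sup>2 / \<sigma>\<^sup>2"
  by (simp add: signal_weight_def valuation_sd_sq add.commute)

lemma signal_weight_pos: "\<tau> > 0"
  using valuation_sd_pos prior_sd_pos by (simp add: signal_weight_eq)

lemma posterior_mean_diff: "\<mu> x - \<mu> y = \<tau> * (x - y)"
  by (simp add: posterior_mean_def algebra_simps)

text \<open>Bayes' rule: the joint density of quality \<open>v\<close> and valuation
  \<open>x\<close>, factored once through the prior and once through the law of the
  valuation.\<close>

lemma joint_density:
  "normal_density \<theta> s\<^sub>\<theta> v * normal_density v s\<^sub>\<epsilon> x = d x * normal_density (\<mu> x) \<sigma>\<^sub>v v"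
proof -
  have sq: "\<sigma>\<^sub>v\<^sup>2 = s\<^sub>\<theta>\<^sup>2 * s\<^sub>\<epsilon>\<^sup>2 / (s\<^sub>\<theta>\<^sup>2 + s\<^sub>\<epsilon>\<^sup>2)"
    by (simp add: posterior_sd_eq power_divide power_mult_distrib valuation_sd_sq mult.commute)
  have const: "sqrt (2 * pi * s\<^sub>\<theta>\<^sup>2) * sqrt (2 * pi * s\<^sub>\<epsilon>\<^sup>2) = sqrt (2 * pi * \<sigma>\<^sup>2) * sqrt (2 * pi * \<sigma>\<^sub>v\<^sup>2)"
  proof -
    have "sqrt (2 * pi * s\<^sup>2) = sqrt (2 * pi) * s" if "s > 0" for s :: real
      using that by (simp add: real_sqrt_mult)
    then show ?thesis
      using valuation_sd_pos prior_sd_pos noise_sd_pos posterior_sd_pos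
      by (simp add: posterior_sd_eq del: real_sqrt_mult)
  qed
  have half: "- X / (2 * a) + - Y / (2 * b) = - (X / a + Y / b) / 2" for X Y a b :: real
    by (simp add: add_divide_distrib diff_divide_distrib)
  have eq: "(v - \<theta>)\<^sup>2 / s\<^sub>\<theta>\<^sup>2 + (x - v)\<^sup>2 / s\<^sub>\<epsilon>\<^sup>2 = (x - \<theta>)\<^sup>2 / \<sigma>\<^sup>2 + (v - \<mu> x)\<^sup>2 / \<sigma>\<^sub>v\<^sup>2"
    unfolding sq valuation_sd_sq posterior_mean_def signal_weight_def
    using prior_sd_pos noise_sd_pos by (intro gaussian_exponent_identity) auto
  have expo: "- (v - \<theta>)\<^sup>2 / (2 * s\<^sub>\<theta>\<^sup>2) + - (x - v)\<^sup>2 / (2 * s\<^sub>\<epsilon>\<^sup>2) =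
      - (x - \<theta>)\<^sup>2 / (2 * \<sigma>\<^sup>2) + - (v - \<mu> x)\<^sup>2 / (2 * \<sigma>\<^sub>v\<^sup>2)"
    by (simp only: half eq)
  have "normal_density \<theta> s\<^sub>\<theta> v * normal_density v s\<^sub>\<epsilon> x =
      1 / (sqrt (2 * pi * s\<^sub>\<theta>\<^sup>2) * sqrt (2 * pi * s\<^sub>\<epsilon>\<^sup>2)) *
      exp (- (v - \<theta>)\<^sup>2 / (2 * s\<^sub>\<theta>\<^sup>2) + - (x - v)\<^sup>2 / (2 * s\<^sub>\<epsilon>\<^sup>2))"
    unfolding normal_density_def exp_add by simp
  also have "\<dots> = d x * normal_density (\<mu> x) \<sigma>\<^sub>v v"
    unfolding const expo unfolding normal_density_def exp_add by simp
  finally show ?thesis .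
qed

lemma integrable_sales:
  "integrable lborel (\<lambda>v. \<Phi> ((v - c) / s\<^sub>\<epsilon>) * normal_density \<theta> s\<^sub>\<theta> v)"
  using prior_sd_pos by (intro integrable_std_cdf_mult) auto

text \<open>Fubini for the joint density on quality in \<open>T\<close> and valuation above
  \<open>c\<close>. Integrating out the valuation first gives the left-hand side, integrating out
  the quality first gives the right-hand side.\<close>

lemma integral_sales_disintegrate:
  assumes [measurable]: "T \<in> sets borel"
  shows "(\<integral>v. indicator T v * (\<Phi> ((v - c) / s\<^sub>\<epsilon>) * normal_density \<theta> s\<^sub>\<theta> v) \<partial>lborel) =
    (\<integral>x. indicator {c<..} x * (d x * (\<integral>v. indicator T v * normal_density (\<mu> x) \<sigma>\<^sub>v v \<partial>lborel)) \<partial>lborel)"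
proof -
  define f where "f = (\<lambda>v x. indicator T v * (indicator {c<..} x *
    (normal_density \<theta> s\<^sub>\<theta> v * normal_density v s\<^sub>\<epsilon> x)) :: real)"
  have f1: "(\<integral>x. f v x \<partial>lborel) =
      indicator T v * (\<Phi> ((v - c) / s\<^sub>\<epsilon>) * normal_density \<theta> s\<^sub>\<theta> v)" for v
  proof -
    have eq: "f v x = (indicator T v * normal_density \<theta> s\<^sub>\<theta> v) *
        (indicator {c<..} x * normal_density v s\<^sub>\<epsilon> x)" for x
      by (simp add: f_def mult_ac)
    show ?thesis
      unfolding eq integral_mult_right_zero integral_normal_density_greaterThan[OF noise_sd_pos]
      by (simp only: mult_ac)
  qed
  have f2: "(\<integral>v. f v x \<partial>lborel) =
      indicator {c<..} x * (d x * (\<integral>v. indicator T v * normal_density (\<mu> x) \<sigma>\<^sub>v v \<partial>lborel))" for x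
  proof -
    have eq: "f v x = (indicator {c<..} x * d x) * (indicator T v * normal_density (\<mu> x) \<sigma>\<^sub>v v)" for v
      by (simp add: f_def joint_density mult_ac)
    show ?thesis
      unfolding eq integral_mult_right_zero by (simp only: mult_ac)
  qed
  have f_nonneg: "0 \<le> f v x" for v x by (simp add: f_def)
  have meas: "(\<lambda>(v, x). f v x) \<in> borel_measurable (lborel \<Otimes>\<^sub>M lborel)"
    unfolding f_def normal_density_def by measurable
  have int: "integrable (lborel \<Otimes>\<^sub>M lborel) (\<lambda>(v, x). f v x)"
  proof (rule lborel_pair.Fubini_integrable[OF meas])
    have "integrable lborel (\<lambda>v. indicator T v * (\<Phi> ((v - c) / s\<^sub>\<epsilon>) * normal_density \<theta> s\<^sub>\<theta> v))"
      by (intro integrable_indicator_mult integrable_sales assms)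
    then show "integrable lborel (\<lambda>v. \<integral>x. norm (case (v, x) of (v, x) \<Rightarrow> f v x) \<partial>lborel)"
      using f_nonneg by (simp add: f1)
    show "AE v in lborel. integrable lborel (\<lambda>x. case (v, x) of (v, x) \<Rightarrow> f v x)"
      using noise_sd_pos unfolding f_def prod.case
      by (intro AE_I2 integrable_mult_right integrable_indicator_mult) auto
  qed
  show ?thesis
    using lborel_pair.Fubini_integral[OF int] by (simp add: f1 f2)
qed

lemma integral_sales:
  "(\<integral>v. \<Phi> ((v - c) / s\<^sub>\<epsilon>) * normal_density \<theta> s\<^sub>\<theta> v \<partial>lborel) = D c"
  using integral_sales_disintegrate[of UNIV c]
  by (simp add: posterior_sd_pos valuation_sd_pos integral_normal_density_greaterThan)

text \<open>The joint probability that the quality is at most \<open>t\<close> and a consumer buys.\<close>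

definition G :: "real \<Rightarrow> real \<Rightarrow> real"
  where "G c t = (\<integral>v. indicator {..t} v * (\<Phi> ((v - c) / s\<^sub>\<epsilon>) * normal_density \<theta> s\<^sub>\<theta> v) \<partial>lborel)"

text \<open>In the definition of \<open>G\<close> the threshold is a limit of integration; in this
  form the cutoff is one. Each form makes one partial derivative immediate.\<close>

lemma G_eq: "G c t = (\<integral>x. indicator {c<..} x * (d x * \<Phi> ((t - \<mu> x) / \<sigma>\<^sub>v)) \<partial>lborel)"
  unfolding G_def
  by (subst integral_sales_disintegrate)
    (simp_all add: integral_normal_density_atMost posterior_sd_pos)

lemma DERIV_G_threshold:
  "((\<lambda>t. G c t) has_real_derivative \<Phi> ((t - c) / s\<^sub>\<epsilon>) * normal_density \<theta> s\<^sub>\<theta> t) (at t)"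
  unfolding G_def using noise_sd_pos
  by (intro DERIV_integral_atMost[OF integrable_sales]) (intro continuous_intros, simp)

lemma DERIV_G_cutoff:
  "((\<lambda>c. G c t) has_real_derivative - (d c * \<Phi> ((t - \<mu> c) / \<sigma>\<^sub>v))) (at c)"
  unfolding G_eq
proof (rule DERIV_integral_greaterThan)
  show "continuous_on UNIV (\<lambda>x. d x * \<Phi> ((t - \<mu> x) / \<sigma>\<^sub>v))"
    unfolding posterior_mean_def using posterior_sd_pos by (intro continuous_intros) simp
  have [measurable]: "\<mu> \<in> borel_measurable borel"
    unfolding posterior_mean_def by measurable
  show "integrable lborel (\<lambda>x. d x * \<Phi> ((t - \<mu> x) / \<sigma>\<^sub>v))"
    unfolding mult.commute[of "d _"] using valuation_sd_pos
    by (intro integrable_std_cdf_mult) auto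
qed

text \<open>The two partial derivatives combine to a total derivative because the one in the
  threshold is jointly continuous; the chain rule does the rest.\<close>

lemma DERIV_G:
  assumes f: "(f has_real_derivative f') (at z)" and g: "(g has_real_derivative g') (at z)"
  shows "((\<lambda>z. G (f z) (g z)) has_real_derivative
    - (d (f z) * \<Phi> ((g z - \<mu> (f z)) / \<sigma>\<^sub>v)) * f' +
    \<Phi> ((g z - f z) / s\<^sub>\<epsilon>) * normal_density \<theta> s\<^sub>\<theta> (g z) * g') (at z)"
proof -
  define q where "q = (\<lambda>c t. \<Phi> ((t - c) / s\<^sub>\<epsilon>) * normal_density \<theta> s\<^sub>\<theta> t)"
  have "((\<lambda>(c, t). G c t) has_derivative (\<lambda>(hc, ht). - (d (f z) * \<Phi> ((g z - \<mu> (f z)) / \<sigma>\<^sub>v)) * hc +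
      blinfun_apply (blinfun_mult_right (q (f z) (g z))) ht)) (at (f z, g z) within UNIV \<times> UNIV)"
  proof (rule has_derivative_partialsI)
    show "((\<lambda>c. G c (g z)) has_derivative (*) (- (d (f z) * \<Phi> ((g z - \<mu> (f z)) / \<sigma>\<^sub>v)))) (at (f z))"
      using DERIV_G_cutoff[of "g z" "f z"] by (simp add: has_field_derivative_def)
    show "((\<lambda>t. G c t) has_derivative blinfun_apply (blinfun_mult_right (q c t))) (at t)" for c t
      using DERIV_G_threshold[of c t] by (simp add: has_field_derivative_def q_def)
    have "continuous_on UNIV (\<lambda>(c, t). blinfun_mult_right (q c t))"
      unfolding q_def split_beta using noise_sd_pos
      by (intro bounded_linear.continuous_on[OF bounded_linear_blinfun_mult_right] continuous_intros) simp
    then show "continuous (at (f z, g z) within UNIV \<times> UNIV) (\<lambda>(c, t). blinfun_mult_right (q c t))"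
      by (simp add: continuous_on_eq_continuous_within)
  qed auto
  then have "((\<lambda>(c, t). G c t) has_derivative (\<lambda>(hc, ht). - (d (f z) * \<Phi> ((g z - \<mu> (f z)) / \<sigma>\<^sub>v)) * hc +
      q (f z) (g z) * ht)) (at (f z, g z))"
    by simp
  moreover have "((\<lambda>z. (f z, g z)) has_derivative (\<lambda>h. (f' * h, g' * h))) (at z)"
    using f g by (intro has_derivative_Pair) (auto simp: has_field_derivative_def)
  ultimately have "((\<lambda>z. G (f z) (g z)) has_derivative
      (\<lambda>h. - (d (f z) * \<Phi> ((g z - \<mu> (f z)) / \<sigma>\<^sub>v)) * (f' * h) + q (f z) (g z) * (g' * h))) (at z)"
    by (auto dest: has_derivative_compose)
  then show ?thesis
    by (rule has_derivative_imp_has_field_derivative) (simp add: q_def algebra_simps)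
qed

subsection \<open>Raising the effective price\<close>

lemma valuation_density_eq: "d c = \<phi> ((\<theta> - c) / \<sigma>) / \<sigma>"
  using normal_density_std[OF valuation_sd_pos, of c \<theta>] by (simp only: normal_density_swap[of \<theta>])

lemma valuation_density_pos: "d c > 0"
  using valuation_sd_pos by (rule normal_density_pos)

lemma demand_eq: "D c = \<sigma> * mills_ratio ((\<theta> - c) / \<sigma>) * d c"
  using valuation_sd_pos by (simp add: valuation_density_eq mills_ratio_mult_pdf)

lemma DERIV_demand [derivative_intros]:
  assumes "(f has_real_derivative f') (at x)"
  shows "((\<lambda>x. D (f x)) has_real_derivative - d (f x) * f') (at x)"
  using valuation_sd_pos
  by (auto intro!: derivative_eq_intros assms simp: valuation_density_eq)

lemma price_pos: "p > 0"
  using price by (simp add: optimal_price_def)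

lemma price_max: "q * D q \<le> p * D p"
proof (cases "q > 0")
  case False
  then have "q * D q \<le> 0" by (intro mult_nonpos_nonneg) (auto simp: std.cdf_nonneg)
  also have "0 \<le> p * D p" using price_pos by (simp add: std.cdf_nonneg)
  finally show ?thesis .
qed (use price in \<open>auto simp: optimal_price_def\<close>)

text \<open>The first-order condition for the optimal price: it equals the inverse hazard rate of
  the valuation.\<close>

lemma price_eq: "p = \<sigma> * mills_ratio ((\<theta> - p) / \<sigma>)"
proof -
  have "((\<lambda>q. q * D q) has_real_derivative D p - p * d p) (at p)"
    by (auto intro!: derivative_eq_intros)
  then have "D p - p * d p = 0"
    by (rule DERIV_local_max[where d=1]) (auto intro: price_max)
  then show ?thesis
    using valuation_density_pos[of p] by (simp add: demand_eq)
qed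

text \<open>The inverse hazard rate decreases in the price, so below \<open>p\<close> it exceeds the
  price. This is the form in which optimality of \<open>p\<close> enters
  \<open>normal_bathtub\<close>.\<close>

lemma price_less:
  assumes "q < p"
  shows "q < \<sigma> * mills_ratio ((\<theta> - q) / \<sigma>)"
proof -
  have "(\<theta> - p) / \<sigma> < (\<theta> - q) / \<sigma>"
    using assms valuation_sd_pos by (simp add: divide_strict_right_mono)
  then have "p < \<sigma> * mills_ratio ((\<theta> - q) / \<sigma>)"
    using valuation_sd_pos mills_ratio_strict_mono by (subst price_eq) simp
  then show ?thesis using assms by linarith
qed

section \<open>The spread bound and the slope of the indifference condition\<close>

lemma spread_bound_pos: "spread_bound s\<^sub>\<theta> s\<^sub>\<epsilon> > 0"
  using prior_sd_pos noise_sd_pos valuation_sd_pos by (simp add: spread_bound_def)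

lemma reward_pos: "w > 0"
  using spread_bound_pos price_pos by (simp add: SC_reward_def)

lemma reward_le_price: "w \<le> p"
  by (simp add: SC_reward_def)

lemma reward_le_spread_bound: "w \<le> spread_bound s\<^sub>\<theta> s\<^sub>\<epsilon>"
  by (simp add: SC_reward_def)

text \<open>Equality holds when \<open>w\<close> is the spread bound. As
  \<open>sqrt (2 * pi)\<close> is the reciprocal of the peak of \<open>\<phi>\<close>, the spread
  constraint keeps \<open>slope\<close> below 1.\<close>

lemma slope_le: "\<tau> * w * (1 / \<sigma>\<^sub>v) \<le> sqrt (2 * pi)"
proof -
  have "\<tau> * w * (1 / \<sigma>\<^sub>v) \<le> \<tau> * spread_bound s\<^sub>\<theta> s\<^sub>\<epsilon> * (1 / \<sigma>\<^sub>v)"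
    using reward_le_spread_bound signal_weight_pos posterior_sd_pos
    by (intro mult_right_mono mult_left_mono) auto
  also have "\<dots> = sqrt (2 * pi)"
    using prior_sd_pos noise_sd_pos valuation_sd_pos
    by (simp add: signal_weight_eq posterior_sd_eq spread_bound_def power2_eq_square)
  finally show ?thesis .
qed

text \<open>
  \<open>1 - slope z\<close> is the derivative in \<open>c\<close> of the cutoff plus the expected reward of a threshold
  program; the spread constraint is exactly what keeps it nonnegative.
\<close>

definition slope :: "real \<Rightarrow> real"
  where "slope z = \<tau> * w * (1 / \<sigma>\<^sub>v * \<phi> z)"

lemma slope_nonneg: "0 \<le> slope z"
  using signal_weight_pos reward_pos posterior_sd_pos by (simp add: slope_def)

lemma slope_le_exp: "slope z \<le> exp (- z\<^sup>2 / 2)"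
proof -
  have "slope z = \<tau> * w * (1 / \<sigma>\<^sub>v) * \<phi> z" by (simp add: slope_def)
  also have "\<dots> \<le> sqrt (2 * pi) * \<phi> z"
    using slope_le by (intro mult_right_mono) auto
  finally show ?thesis by (simp add: std_normal_density_def)
qed

lemma slope_le_1: "slope z \<le> 1"
  using slope_le_exp[of z] by (rule order_trans) simp

text \<open>
  The program paying \<open>p - q + w\<close> up to a threshold and \<open>p - q\<close> above it amounts to the price \<open>q\<close>
  with reward \<open>w\<close>. It is parametrised by the normalised position \<open>z\<close> of its threshold in the
  posterior of the indifferent consumer.
\<close>

definition cutoff :: "real \<Rightarrow> real \<Rightarrow> real"
  where "cutoff q z = q - w * \<Phi> z"

definition threshold :: "real \<Rightarrow> real \<Rightarrow> real"
  where "threshold q z = \<mu> (cutoff q z) + \<sigma>\<^sub>v * z"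

definition K :: "real \<Rightarrow> real \<Rightarrow> real"
  where "K q z = q * D (cutoff q z) - w * G (cutoff q z) (threshold q z)"

lemma threshold_normalised: "(threshold q z - \<mu> (cutoff q z)) / \<sigma>\<^sub>v = z"
  using posterior_sd_pos by (simp add: threshold_def)

text \<open>With \<open>z\<close> fixed, the cutoff moves at rate 1 and the threshold at rate
  \<open>\<tau>\<close>. The boundary term of \<open>G\<close> at the cutoff turns \<open>q\<close>
  into \<open>q - w * \<Phi> z\<close>, the cutoff itself.\<close>

lemma DERIV_K_price:
  "((\<lambda>q. K q z) has_real_derivative
    D (cutoff q z) - cutoff q z * d (cutoff q z) -
    w * \<tau> * (\<Phi> ((threshold q z - cutoff q z) / s\<^sub>\<epsilon>) * normal_density \<theta> s\<^sub>\<theta> (threshold q z))) (at q)"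
proof -
  have c: "((\<lambda>q. cutoff q z) has_real_derivative 1) (at q)"
    unfolding cutoff_def by (auto intro!: derivative_eq_intros)
  have t: "((\<lambda>q. threshold q z) has_real_derivative \<tau>) (at q)"
    unfolding threshold_def posterior_mean_def by (auto intro!: derivative_eq_intros c)
  show ?thesis
    unfolding K_def
    by (rule derivative_eq_intros DERIV_G c t refl)+
      (simp add: threshold_normalised, simp add: cutoff_def algebra_simps)
qed

lemma DERIV_K_position:
  "((\<lambda>z. K q z) has_real_derivative
    w * \<phi> z * (cutoff q z * d (cutoff q z)) -
    w * (\<sigma>\<^sub>v * (1 - slope z)) *
      (\<Phi> ((threshold q z - cutoff q z) / s\<^sub>\<epsilon>) * normal_density \<theta> s\<^sub>\<theta> (threshold q z))) (at z)"
proof -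
  have c: "((\<lambda>z. cutoff q z) has_real_derivative - w * \<phi> z) (at z)"
    unfolding cutoff_def by (auto intro!: derivative_eq_intros)
  have "\<sigma>\<^sub>v * (1 - slope z) = \<sigma>\<^sub>v - \<tau> * (w * \<phi> z)"
    using posterior_sd_pos by (simp add: slope_def algebra_simps)
  then have t: "((\<lambda>z. threshold q z) has_real_derivative \<sigma>\<^sub>v * (1 - slope z)) (at z)"
    unfolding threshold_def posterior_mean_def by (auto intro!: derivative_eq_intros c)
  show ?thesis
    unfolding K_def
    by (rule derivative_eq_intros DERIV_G c t refl)+
      (simp add: threshold_normalised, simp add: cutoff_def algebra_simps)
qed

text \<open>The cost of the moving threshold is, by \<open>joint_density\<close>, the integral of
  \<open>f x * d x\<close> over valuations above the cutoff, where \<open>f x\<close> is the slope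
  at the position of the threshold in the posterior of \<open>x\<close>. These weights lie in the
  unit interval and have mass \<open>q - c\<close> beyond the cutoff, so
  \<open>normal_bathtub\<close> applies.\<close>

lemma K_price_deriv_pos:
  assumes "q < p" "0 \<le> cutoff q z"
  shows "w * \<tau> * (\<Phi> ((threshold q z - cutoff q z) / s\<^sub>\<epsilon>) * normal_density \<theta> s\<^sub>\<theta> (threshold q z))
    < D (cutoff q z) - cutoff q z * d (cutoff q z)"
proof -
  define c t where "c = cutoff q z" and "t = threshold q z"
  \<comment> \<open>The position \<open>(t - \<mu> x) / \<sigma>\<^sub>v\<close> is affine in
    \<open>x\<close>, with slope \<open>- 1 / \<rho>\<close> and zero \<open>m\<close>. Hence the
    weights are \<open>w\<close> times a normal density in \<open>x\<close>.\<close>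
  define \<rho> m where "\<rho> = \<sigma>\<^sub>v / \<tau>" and "m = c + \<rho> * z"
  have \<rho>: "\<rho> > 0" using posterior_sd_pos signal_weight_pos by (simp add: \<rho>_def)
  define f where "f = (\<lambda>x. w * normal_density m \<rho> x)"
  have arg: "(x - m) / \<rho> = - ((t - \<mu> x) / \<sigma>\<^sub>v)" for x
  proof -
    have "t - \<mu> x = \<sigma>\<^sub>v * z - \<tau> * (x - c)"
      using posterior_mean_diff[of x c] by (simp add: t_def threshold_def c_def)
    then show ?thesis
      using posterior_sd_pos signal_weight_pos by (simp add: \<rho>_def m_def) (simp add: field_simps)
  qed
  have f_eq: "f x = slope ((t - \<mu> x) / \<sigma>\<^sub>v)" for x
    unfolding f_def normal_density_std[OF \<rho>] arg std_pdf_minus slope_def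
    using posterior_sd_pos signal_weight_pos by (simp add: \<rho>_def)
  have f_d: "f x * d x = w * \<tau> * normal_density \<theta> s\<^sub>\<theta> t * normal_density t s\<^sub>\<epsilon> x" for x
  proof -
    have "f x = w * \<tau> * normal_density (\<mu> x) \<sigma>\<^sub>v t"
      using posterior_sd_pos by (simp add: f_eq slope_def normal_density_std[of "\<sigma>\<^sub>v" "\<mu> x"])
    then show ?thesis using joint_density[of t x] by (simp add: mult_ac)
  qed
  have "c * d c + (\<integral>x. indicator {c<..} x * (f x * d x) \<partial>lborel) < D c"
  proof (rule normal_bathtub[OF valuation_sd_pos, where q=q])
    show "integrable lborel f" using \<rho> by (simp add: f_def)
    show "0 \<le> f x" "f x \<le> 1" for x by (simp_all add: f_eq slope_nonneg slope_le_1)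
    have "(\<integral>x. indicator {c<..} x * f x \<partial>lborel) =
        (\<integral>x. w * (indicator {c<..} x * normal_density m \<rho> x) \<partial>lborel)"
      by (simp add: f_def mult_ac)
    also have "\<dots> = w * \<Phi> ((m - c) / \<rho>)"
      unfolding integral_mult_right_zero integral_normal_density_greaterThan[OF \<rho>] ..
    also have "\<dots> = q - c" using \<rho> by (simp add: m_def c_def cutoff_def)
    finally show "(\<integral>x. indicator {c<..} x * f x \<partial>lborel) = q - c" .
  qed (use assms price_less in \<open>auto simp: c_def\<close>)
  also have "(\<lambda>x. indicator {c<..} x * (f x * d x)) =
      (\<lambda>x. w * \<tau> * normal_density \<theta> s\<^sub>\<theta> t * (indicator {c<..} x * normal_density t s\<^sub>\<epsilon> x))"
    by (simp add: f_d fun_eq_iff mult_ac)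
  finally show ?thesis
    unfolding integral_mult_right_zero integral_normal_density_greaterThan[OF noise_sd_pos]
    by (simp add: c_def t_def mult_ac)
qed

lemma K_price_less:
  assumes "q < p" "0 \<le> cutoff q z"
  shows "K q z < K p z"
proof (rule DERIV_pos_imp_increasing_open[OF assms(1)])
  fix x assume x: "q < x" "x < p"
  then have "0 \<le> cutoff x z" using assms by (simp add: cutoff_def)
  then have "w * \<tau> * (\<Phi> ((threshold x z - cutoff x z) / s\<^sub>\<epsilon>) * normal_density \<theta> s\<^sub>\<theta> (threshold x z))
      < D (cutoff x z) - cutoff x z * d (cutoff x z)"
    by (rule K_price_deriv_pos[OF x(2)])
  then show "\<exists>y. ((\<lambda>q. K q z) has_real_derivative y) (at x) \<and> 0 < y"
    by (intro exI[of _ "D (cutoff x z) - cutoff x z * d (cutoff x z) - w * \<tau> *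
        (\<Phi> ((threshold x z - cutoff x z) / s\<^sub>\<epsilon>) * normal_density \<theta> s\<^sub>\<theta> (threshold x z))"] conjI DERIV_K_price)
      (simp only: diff_gt_0_iff_gt)
next
  show "continuous_on {q..p} (\<lambda>q. K q z)"
    by (rule DERIV_continuous_on, rule has_field_derivative_at_within, rule DERIV_K_price)
qed

subsection \<open>The optimal threshold\<close>

text \<open>By \<open>joint_density\<close> at valuation \<open>c\<close> and quality
  \<open>t\<close>, both terms of the derivative share the factor \<open>w * \<phi> z * d c\<close>.
  The remaining factor vanishes exactly when the second equation of the system, with its denominator
  cleared, holds.\<close>

lemma DERIV_K_position':
  fixes q z :: real
  defines "c \<equiv> cutoff q z" and "t \<equiv> threshold q z"
  shows "((\<lambda>z. K q z) has_real_derivative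
    w * \<phi> z * d c * (c - (1 - slope z) * (s\<^sub>\<epsilon> * mills_ratio ((t - c) / s\<^sub>\<epsilon>)))) (at z)"
proof -
  define a where "a = (t - c) / s\<^sub>\<epsilon>"
  have "normal_density t s\<^sub>\<epsilon> c = \<phi> a / s\<^sub>\<epsilon>"
    unfolding a_def normal_density_std[OF noise_sd_pos, symmetric] normal_density_swap[of t]
    by (rule refl)
  moreover have "normal_density (\<mu> c) \<sigma>\<^sub>v t = \<phi> z / \<sigma>\<^sub>v"
    unfolding normal_density_std[OF posterior_sd_pos] c_def t_def threshold_normalised ..
  ultimately have "normal_density \<theta> s\<^sub>\<theta> t * \<phi> a / s\<^sub>\<epsilon> = d c * \<phi> z / \<sigma>\<^sub>v"
    using joint_density[of t c] by simp
  then have "\<sigma>\<^sub>v * (\<phi> a * normal_density \<theta> s\<^sub>\<theta> t) = s\<^sub>\<epsilon> * (d c * \<phi> z)"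
    using posterior_sd_pos noise_sd_pos by (simp add: field_simps)
  then have "\<sigma>\<^sub>v * (\<Phi> a * normal_density \<theta> s\<^sub>\<theta> t) = mills_ratio a * (s\<^sub>\<epsilon> * (d c * \<phi> z))"
    unfolding mills_ratio_mult_pdf[of a, symmetric] by (metis mult.assoc mult.left_commute)
  then have "w * (\<sigma>\<^sub>v * (1 - slope z)) * (\<Phi> a * normal_density \<theta> s\<^sub>\<theta> t) =
      w * (1 - slope z) * (mills_ratio a * (s\<^sub>\<epsilon> * (d c * \<phi> z)))"
    by (metis mult.assoc mult.commute)
  then have "w * \<phi> z * (c * d c) - w * (\<sigma>\<^sub>v * (1 - slope z)) * (\<Phi> a * normal_density \<theta> s\<^sub>\<theta> t) =
      w * \<phi> z * d c * (c - (1 - slope z) * (s\<^sub>\<epsilon> * mills_ratio a))"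
    by (simp add: algebra_simps)
  then show ?thesis
    using DERIV_K_position[of q z] by (simp only: a_def c_def t_def)
qed

lemma continuous_K_position: "continuous_on A (\<lambda>z. K q z)"
  by (rule DERIV_continuous_on, rule has_field_derivative_at_within, rule DERIV_K_position')

section \<open>Behaviour of the profit for extreme positions of the threshold\<close>

lemma cutoff_bounds: "0 < cutoff p z" "cutoff p z < p"
proof -
  have "w * \<Phi> z < w * 1" using reward_pos by (intro mult_strict_left_mono) auto
  then show "0 < cutoff p z" using reward_le_price by (simp add: cutoff_def)
  have "0 < w * \<Phi> z" using reward_pos by (intro mult_pos_pos) auto
  then show "cutoff p z < p" by (simp add: cutoff_def)
qed

lemma signal_weight_less_1: "\<tau> < 1"
  using prior_sd_pos noise_sd_pos by (simp add: signal_weight_def divide_simps add_pos_pos)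

lemma threshold_minus_cutoff:
  "threshold p z - cutoff p z = (1 - \<tau>) * (\<theta> - cutoff p z) + \<sigma>\<^sub>v * z"
  by (simp add: threshold_def posterior_mean_def algebra_simps)

lemma threshold_minus_cutoff_bounds:
  "threshold p z - cutoff p z \<le> \<bar>\<theta>\<bar> + \<sigma>\<^sub>v * z"
  "- \<bar>\<theta>\<bar> - p + \<sigma>\<^sub>v * z \<le> threshold p z - cutoff p z"
proof -
  have w: "0 \<le> 1 - \<tau>" "1 - \<tau> \<le> 1" using signal_weight_pos signal_weight_less_1 by auto
  have "(1 - \<tau>) * (\<theta> - cutoff p z) \<le> (1 - \<tau>) * \<bar>\<theta>\<bar>"
    using w cutoff_bounds[of z] by (intro mult_left_mono) auto
  also have "\<dots> \<le> \<bar>\<theta>\<bar>" using w by (intro mult_left_le_one_le) auto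
  finally show "threshold p z - cutoff p z \<le> \<bar>\<theta>\<bar> + \<sigma>\<^sub>v * z"
    by (simp add: threshold_minus_cutoff)
  have "(1 - \<tau>) * (cutoff p z - \<theta>) \<le> (1 - \<tau>) * (p + \<bar>\<theta>\<bar>)"
    using w cutoff_bounds[of z] by (intro mult_left_mono) auto
  also have "\<dots> \<le> p + \<bar>\<theta>\<bar>" using w price_pos by (intro mult_left_le_one_le) auto
  finally show "- \<bar>\<theta>\<bar> - p + \<sigma>\<^sub>v * z \<le> threshold p z - cutoff p z"
    by (simp add: threshold_minus_cutoff algebra_simps)
qed

lemma K_eventually_increasing:
  obtains z\<^sub>0 where "z\<^sub>0 \<le> 0" "\<And>y z. y < z \<Longrightarrow> z \<le> z\<^sub>0 \<Longrightarrow> K p y < K p z"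
proof
  \<comment> \<open>The bound 0 gives \<open>\<Phi> x \<le> 1 / 2\<close> and so a cutoff of at
    least \<open>p / 2\<close>. The other bound forces
    \<open>p * a \<le> - 2 * s\<^sub>\<epsilon>\<close>, hence
    \<open>s\<^sub>\<epsilon> * mills_ratio a \<le> p / 2\<close>; the positive slope makes the
    comparison strict.\<close>
  define z\<^sub>0 where "z\<^sub>0 = min 0 ((- 2 * s\<^sub>\<epsilon>\<^sup>2 / p - \<bar>\<theta>\<bar>) / \<sigma>\<^sub>v)"
  show "z\<^sub>0 \<le> 0" by (simp add: z\<^sub>0_def)
  fix y z assume "y < z" "z \<le> z\<^sub>0"
  show "K p y < K p z"
  proof (rule DERIV_pos_imp_increasing[OF \<open>y < z\<close>])
    fix x assume "x \<le> z"
    with \<open>z \<le> z\<^sub>0\<close> have x: "x \<le> 0" "x \<le> (- 2 * s\<^sub>\<epsilon>\<^sup>2 / p - \<bar>\<theta>\<bar>) / \<sigma>\<^sub>v"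
      by (auto simp: z\<^sub>0_def)
    define c a where "c = cutoff p x" and "a = (threshold p x - c) / s\<^sub>\<epsilon>"
    have "\<sigma>\<^sub>v * x \<le> - 2 * s\<^sub>\<epsilon>\<^sup>2 / p - \<bar>\<theta>\<bar>"
      using x(2) posterior_sd_pos by (simp add: pos_le_divide_eq mult.commute)
    then have "s\<^sub>\<epsilon> * a \<le> - 2 * s\<^sub>\<epsilon>\<^sup>2 / p"
      using threshold_minus_cutoff_bounds(1)[of x] noise_sd_pos by (simp add: a_def c_def)
    then have "p * (s\<^sub>\<epsilon> * a) \<le> p * (- 2 * s\<^sub>\<epsilon>\<^sup>2 / p)"
      using price_pos by (intro mult_left_mono) auto
    then have "s\<^sub>\<epsilon> * (p * a) \<le> s\<^sub>\<epsilon> * (- 2 * s\<^sub>\<epsilon>)"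
      using price_pos by (simp add: power2_eq_square mult_ac)
    then have a: "p * a \<le> - 2 * s\<^sub>\<epsilon>"
      using noise_sd_pos by (simp only: mult_le_cancel_left_pos)
    then have "p * a < 0" using noise_sd_pos by linarith
    then have "a < 0" using price_pos by (simp add: mult_less_0_iff)
    have "s\<^sub>\<epsilon> * mills_ratio a \<le> s\<^sub>\<epsilon> * (- 1 / a)"
      using mills_ratio_neg_less[OF \<open>a < 0\<close>] noise_sd_pos by (intro mult_left_mono) auto
    also have "\<dots> \<le> p / 2"
      using a \<open>a < 0\<close> by (simp add: field_simps)
    finally have "s\<^sub>\<epsilon> * mills_ratio a \<le> p / 2" .
    moreover have "slope x > 0"
      using signal_weight_pos reward_pos posterior_sd_pos by (simp add: slope_def)
    then have "(1 - slope x) * (s\<^sub>\<epsilon> * mills_ratio a) < 1 * (s\<^sub>\<epsilon> * mills_ratio a)"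
      using noise_sd_pos by (intro mult_strict_right_mono) auto
    moreover have "w * \<Phi> x \<le> p * (1 / 2)"
      using std_cdf_mono[OF x(1)] reward_le_price price_pos
      by (intro mult_mono) (auto simp: std_cdf_zero std.cdf_nonneg)
    then have "p / 2 \<le> c" by (simp add: c_def cutoff_def)
    ultimately have "0 < c - (1 - slope x) * (s\<^sub>\<epsilon> * mills_ratio a)" by linarith
    then have "0 < w * \<phi> x * d c * (c - (1 - slope x) * (s\<^sub>\<epsilon> * mills_ratio a))"
      using reward_pos valuation_density_pos by (intro mult_pos_pos) auto
    then show "\<exists>D. ((\<lambda>z. K p z) has_real_derivative D) (at x) \<and> 0 < D"
      using DERIV_K_position'[of p x] unfolding a_def c_def by blast
  qed
qed

lemma K_eventually_decreasing:
  obtains z\<^sub>1 where "0 \<le> z\<^sub>1" "\<And>y z. y < z \<Longrightarrow> z\<^sub>1 \<le> y \<Longrightarrow> K p z < K p y"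
proof
  \<comment> \<open>The bound 2 makes the slope at most \<open>1 / 2\<close>. The other bound makes
    \<open>s\<^sub>\<epsilon> * a\<close>, and with it
    \<open>s\<^sub>\<epsilon> * mills_ratio a\<close>, at least \<open>2 * p\<close>; the product
    then exceeds the cutoff, which is below \<open>p\<close>.\<close>
  define z\<^sub>1 where "z\<^sub>1 = max 2 ((3 * p + \<bar>\<theta>\<bar>) / \<sigma>\<^sub>v)"
  show "0 \<le> z\<^sub>1" by (simp add: z\<^sub>1_def)
  fix y z assume "y < z" "z\<^sub>1 \<le> y"
  show "K p z < K p y"
  proof (rule DERIV_neg_imp_decreasing[OF \<open>y < z\<close>])
    fix x assume "y \<le> x"
    with \<open>z\<^sub>1 \<le> y\<close> have x: "2 \<le> x" "(3 * p + \<bar>\<theta>\<bar>) / \<sigma>\<^sub>v \<le> x"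
      by (auto simp: z\<^sub>1_def)
    define c a where "c = cutoff p x" and "a = (threshold p x - c) / s\<^sub>\<epsilon>"
    have "3 * p + \<bar>\<theta>\<bar> \<le> \<sigma>\<^sub>v * x"
      using x(2) posterior_sd_pos by (simp add: pos_divide_le_eq mult.commute)
    then have a: "2 * p \<le> s\<^sub>\<epsilon> * a"
      using threshold_minus_cutoff_bounds(2)[of x] noise_sd_pos by (simp add: a_def c_def)
    then have "0 \<le> s\<^sub>\<epsilon> * a" using price_pos by linarith
    then have "0 \<le> a" using noise_sd_pos by (simp add: zero_le_mult_iff)
    then have "s\<^sub>\<epsilon> * a \<le> s\<^sub>\<epsilon> * mills_ratio a"
      using noise_sd_pos by (intro mult_left_mono mills_ratio_ge_id) auto
    then have h: "2 * p \<le> s\<^sub>\<epsilon> * mills_ratio a" using a by linarith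
    have "2\<^sup>2 \<le> x\<^sup>2" using x(1) by (intro power_mono) auto
    then have "exp (- x\<^sup>2 / 2) \<le> exp (- 1 :: real)" by simp
    also have "exp (- 1 :: real) \<le> 1 / 2"
      using exp_ge_add_one_self[of "1 :: real"] by (simp add: exp_minus field_simps)
    finally have "1 / 2 \<le> 1 - slope x" using slope_le_exp[of x] by linarith
    then have "1 / 2 * (2 * p) \<le> (1 - slope x) * (s\<^sub>\<epsilon> * mills_ratio a)"
      using price_pos by (intro mult_mono[OF _ h]) auto
    then have "c - (1 - slope x) * (s\<^sub>\<epsilon> * mills_ratio a) < 0"
      using cutoff_bounds(2)[of x] by (simp add: c_def)
    then have "w * \<phi> x * d c * (c - (1 - slope x) * (s\<^sub>\<epsilon> * mills_ratio a)) < 0"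
      using reward_pos valuation_density_pos by (intro mult_pos_neg mult_pos_pos) auto
    then show "\<exists>D. ((\<lambda>z. K p z) has_real_derivative D) (at x) \<and> D < 0"
      using DERIV_K_position'[of p x] unfolding a_def c_def by blast
  qed
qed

text \<open>Demand is at least \<open>D p\<close>, as the cutoff is below \<open>p\<close>, and
  rewards cost at most \<open>w\<close> times the prior probability of a quality below the
  threshold. That probability vanishes as \<open>z\<close> tends to minus infinity.\<close>

lemma K_lower_bound: "p * D p - w * \<Phi> ((p + \<sigma>\<^sub>v * z + \<bar>\<theta>\<bar> - \<theta>) / s\<^sub>\<theta>) \<le> K p z"
proof -
  define c t where "c = cutoff p z" and "t = threshold p z"
  have "D p \<le> D c"
    using cutoff_bounds(2)[of z] valuation_sd_pos
    by (intro std_cdf_mono divide_right_mono) (auto simp: c_def)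
  then have "p * D p \<le> p * D c" using price_pos by (intro mult_left_mono) auto
  moreover have "G c t \<le> \<Phi> ((p + \<sigma>\<^sub>v * z + \<bar>\<theta>\<bar> - \<theta>) / s\<^sub>\<theta>)"
  proof -
    have "G c t \<le> (\<integral>v. indicator {..t} v * normal_density \<theta> s\<^sub>\<theta> v \<partial>lborel)"
      unfolding G_def using prior_sd_pos
      by (intro integral_mono integrable_indicator_mult integrable_sales)
        (auto intro!: mult_left_mono mult_left_le_one_le less_imp_le[OF std_cdf_less_1] simp: std.cdf_nonneg)
    also have "\<dots> = \<Phi> ((t - \<theta>) / s\<^sub>\<theta>)"
      by (rule integral_normal_density_atMost[OF prior_sd_pos])
    also have "\<dots> \<le> \<Phi> ((p + \<sigma>\<^sub>v * z + \<bar>\<theta>\<bar> - \<theta>) / s\<^sub>\<theta>)"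
      using threshold_minus_cutoff_bounds(1)[of z] cutoff_bounds(2)[of z] prior_sd_pos
      by (intro std_cdf_mono divide_right_mono) (auto simp: t_def)
    finally show ?thesis .
  qed
  then have "w * G c t \<le> w * \<Phi> ((p + \<sigma>\<^sub>v * z + \<bar>\<theta>\<bar> - \<theta>) / s\<^sub>\<theta>)"
    using reward_pos by (intro mult_left_mono) auto
  ultimately show ?thesis by (simp add: K_def c_def t_def)
qed

lemma K_max:
  obtains z where "\<And>y. K p y \<le> K p z" "p * D p < K p z"
proof -
  obtain z\<^sub>0 where z\<^sub>0: "z\<^sub>0 \<le> 0" "\<And>y z. y < z \<Longrightarrow> z \<le> z\<^sub>0 \<Longrightarrow> K p y < K p z"
    using K_eventually_increasing by blast
  obtain z\<^sub>1 where z\<^sub>1: "0 \<le> z\<^sub>1" "\<And>y z. y < z \<Longrightarrow> z\<^sub>1 \<le> y \<Longrightarrow> K p z < K p y"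
    using K_eventually_decreasing by blast
  obtain z where z: "\<forall>y\<in>{z\<^sub>0..z\<^sub>1}. K p y \<le> K p z"
    using continuous_attains_sup[OF compact_Icc _ continuous_K_position[of "{z\<^sub>0..z\<^sub>1}" p]] z\<^sub>0(1) z\<^sub>1(1)
    by auto
  have max: "K p y \<le> K p z" for y
  proof -
    consider "y < z\<^sub>0" | "y \<in> {z\<^sub>0..z\<^sub>1}" | "z\<^sub>1 < y" by fastforce
    then show ?thesis
    proof cases
      case 1
      then show ?thesis using z\<^sub>0(2)[of y z\<^sub>0] bspec[OF z, of z\<^sub>0] z\<^sub>0(1) z\<^sub>1(1) by simp
    next
      case 3
      then show ?thesis using z\<^sub>1(2)[of z\<^sub>1 y] bspec[OF z, of z\<^sub>1] z\<^sub>0(1) z\<^sub>1(1) by simp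
    qed (use z in blast)
  qed
  \<comment> \<open>The lower bound tends to \<open>p * D p\<close>, the profit without rewards.
    Since \<open>K p\<close> increases up to \<open>z\<^sub>0\<close>, its value at
    \<open>z\<^sub>0 - 1\<close> is at least this limit, and the step on to \<open>z\<^sub>0\<close>
    makes the inequality strict.\<close>
  have "filterlim (\<lambda>y. (p + \<sigma>\<^sub>v * y + \<bar>\<theta>\<bar> - \<theta>) / s\<^sub>\<theta>) at_bot at_bot"
    unfolding filterlim_at_bot
  proof
    fix Z
    show "\<forall>\<^sub>F y in at_bot. (p + \<sigma>\<^sub>v * y + \<bar>\<theta>\<bar> - \<theta>) / s\<^sub>\<theta> \<le> Z"
      using eventually_le_at_bot[of "(Z * s\<^sub>\<theta> - (p + \<bar>\<theta>\<bar> - \<theta>)) / \<sigma>\<^sub>v"]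
    proof eventually_elim
      case (elim y)
      then have "\<sigma>\<^sub>v * y \<le> Z * s\<^sub>\<theta> - (p + \<bar>\<theta>\<bar> - \<theta>)"
        using posterior_sd_pos by (simp add: pos_le_divide_eq mult.commute)
      then show ?case using prior_sd_pos by (simp add: pos_divide_le_eq)
    qed
  qed
  then have "((\<lambda>y. p * D p - w * \<Phi> ((p + \<sigma>\<^sub>v * y + \<bar>\<theta>\<bar> - \<theta>) / s\<^sub>\<theta>)) \<longlongrightarrow> p * D p - w * 0) at_bot"
    by (intro tendsto_intros filterlim_compose[OF std.cdf_lim_at_bot])
  moreover have "\<forall>\<^sub>F y in at_bot. p * D p - w * \<Phi> ((p + \<sigma>\<^sub>v * y + \<bar>\<theta>\<bar> - \<theta>) / s\<^sub>\<theta>) \<le> K p (z\<^sub>0 - 1)"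
    using eventually_gt_at_bot[of "z\<^sub>0 - 1"]
  proof eventually_elim
    case (elim y)
    then show ?case using z\<^sub>0(2)[of y "z\<^sub>0 - 1"] K_lower_bound[of y] by simp
  qed
  ultimately have "p * D p - w * 0 \<le> K p (z\<^sub>0 - 1)"
    by (rule tendsto_upperbound) simp
  also have "K p (z\<^sub>0 - 1) < K p z\<^sub>0" by (rule z\<^sub>0(2)) auto
  also have "\<dots> \<le> K p z" by (rule max)
  finally have "p * D p < K p z" by simp
  with max show thesis by (rule that)
qed

lemma SC_system_if_K_max:
  assumes "\<And>y. K p y \<le> K p z"
  shows "SC_system \<theta> s\<^sub>\<theta> s\<^sub>\<epsilon> p (cutoff p z) (threshold p z)"
proof -
  define c a where "c = cutoff p z" and "a = (threshold p z - c) / s\<^sub>\<epsilon>"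
  have "w * \<phi> z * d c * (c - (1 - slope z) * (s\<^sub>\<epsilon> * mills_ratio a)) = 0"
    using DERIV_local_max[OF DERIV_K_position'[of p z], of 1] assms by (simp add: c_def a_def)
  then have foc: "c = (1 - slope z) * (s\<^sub>\<epsilon> * mills_ratio a)"
    using reward_pos valuation_density_pos[of c] by simp
  \<comment> \<open>Slope 1 would give \<open>c = 0\<close> in the first-order condition, so
    positivity of the cutoff permits division by \<open>1 - slope z\<close>.\<close>
  have "c > 0" using cutoff_bounds(1) by (simp add: c_def)
  with foc have "1 - slope z \<noteq> 0" by force
  with foc have "s\<^sub>\<epsilon> * mills_ratio a = c / (1 - slope z)" by simp
  moreover have "\<Phi> a / (1 / s\<^sub>\<epsilon> * \<phi> a) = s\<^sub>\<epsilon> * mills_ratio a"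
    by (simp add: mills_ratio_def)
  moreover have "p = c + w * \<Phi> z" by (simp add: c_def cutoff_def)
  ultimately show ?thesis
    unfolding SC_system_def c_def[symmetric] using threshold_normalised[of p z]
    by (simp add: a_def slope_def c_def)
qed

subsection \<open>Reduction to threshold programs\<close>

lemma posterior_integral:
  assumes "r \<in> borel_measurable borel"
  shows "(\<integral>v. r v \<partial>posterior \<theta> s\<^sub>\<theta> s\<^sub>\<epsilon> c) = (\<integral>v. r v * normal_density (\<mu> c) \<sigma>\<^sub>v v \<partial>lborel)"
  unfolding posterior_def by (rule integral_normal_measure[OF assms])

lemma profit_eq:
  assumes [measurable]: "r \<in> borel_measurable borel" and "\<And>v. \<bar>r v\<bar> \<le> B"
  shows "profit \<theta> s\<^sub>\<theta> s\<^sub>\<epsilon> p r c =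
    p * D c - (\<integral>v. r v * (\<Phi> ((v - c) / s\<^sub>\<epsilon>) * normal_density \<theta> s\<^sub>\<theta> v) \<partial>lborel)"
proof -
  have "profit \<theta> s\<^sub>\<theta> s\<^sub>\<epsilon> p r c =
      (\<integral>v. (p - r v) * \<Phi> ((v - c) / s\<^sub>\<epsilon>) * normal_density \<theta> s\<^sub>\<theta> v \<partial>lborel)"
    unfolding profit_def prior_def by (rule integral_normal_measure) measurable
  also have "\<dots> = (\<integral>v. p * (\<Phi> ((v - c) / s\<^sub>\<epsilon>) * normal_density \<theta> s\<^sub>\<theta> v) -
      r v * (\<Phi> ((v - c) / s\<^sub>\<epsilon>) * normal_density \<theta> s\<^sub>\<theta> v) \<partial>lborel)"
    by (simp add: algebra_simps)
  also have "\<dots> = p * D c - (\<integral>v. r v * (\<Phi> ((v - c) / s\<^sub>\<epsilon>) * normal_density \<theta> s\<^sub>\<theta> v) \<partial>lborel)"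
    using integrable_sales[of c] integrable_bounded_mult[OF assms(1) integrable_sales assms(2)]
    by (simp add: integral_sales)
  finally show ?thesis .
qed

lemma profit_AE_const:
  assumes "r \<in> borel_measurable borel" "\<And>v. \<bar>r v\<bar> \<le> B" and ae: "AE v in lborel. r v = k"
  shows "profit \<theta> s\<^sub>\<theta> s\<^sub>\<epsilon> p r c = (p - k) * D c"
proof -
  note [measurable] = assms(1)
  have "(\<integral>v. r v * (\<Phi> ((v - c) / s\<^sub>\<epsilon>) * normal_density \<theta> s\<^sub>\<theta> v) \<partial>lborel) =
      (\<integral>v. k * (\<Phi> ((v - c) / s\<^sub>\<epsilon>) * normal_density \<theta> s\<^sub>\<theta> v) \<partial>lborel)"
    by (rule integral_cong_AE) (use ae in auto)
  then show ?thesis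
    by (simp add: profit_eq[OF assms(1,2)] integral_sales left_diff_distrib)
qed

lemma profit_threshold:
  "profit \<theta> s\<^sub>\<theta> s\<^sub>\<epsilon> p (\<lambda>v. m + threshold_program w t v) c = (p - m) * D c - w * G c t"
proof -
  have "profit \<theta> s\<^sub>\<theta> s\<^sub>\<epsilon> p (\<lambda>v. m + threshold_program w t v) c = p * D c -
      (\<integral>v. (m + threshold_program w t v) * (\<Phi> ((v - c) / s\<^sub>\<epsilon>) * normal_density \<theta> s\<^sub>\<theta> v) \<partial>lborel)"
    using reward_pos
    by (intro profit_eq[where B="\<bar>m\<bar> + w"]) (auto simp: threshold_program_def split: split_indicator)
  also have "(\<integral>v. (m + threshold_program w t v) * (\<Phi> ((v - c) / s\<^sub>\<epsilon>) * normal_density \<theta> s\<^sub>\<theta> v) \<partial>lborel) =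
      (\<integral>v. m * (\<Phi> ((v - c) / s\<^sub>\<epsilon>) * normal_density \<theta> s\<^sub>\<theta> v) +
        w * (indicator {..t} v * (\<Phi> ((v - c) / s\<^sub>\<epsilon>) * normal_density \<theta> s\<^sub>\<theta> v)) \<partial>lborel)"
    by (simp add: threshold_program_def algebra_simps)
  also have "\<dots> = m * D c + w * G c t"
    using integrable_sales[of c] integrable_indicator_mult[OF integrable_sales[of c], of "{..t}"]
    by (simp add: integral_sales G_def)
  finally show ?thesis by (simp add: algebra_simps)
qed

lemma posterior_integral_threshold:
  "(\<integral>v. m + threshold_program w t v \<partial>posterior \<theta> s\<^sub>\<theta> s\<^sub>\<epsilon> c) = m + w * \<Phi> ((t - \<mu> c) / \<sigma>\<^sub>v)"
proof -
  have "(\<integral>v. m + threshold_program w t v \<partial>posterior \<theta> s\<^sub>\<theta> s\<^sub>\<epsilon> c) =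
      (\<integral>v. (m + threshold_program w t v) * normal_density (\<mu> c) \<sigma>\<^sub>v v \<partial>lborel)"
    by (rule posterior_integral) (simp add: threshold_program_def)
  also have "\<dots> = (\<integral>v. m * normal_density (\<mu> c) \<sigma>\<^sub>v v +
      w * (indicator {..t} v * normal_density (\<mu> c) \<sigma>\<^sub>v v) \<partial>lborel)"
    by (simp add: threshold_program_def algebra_simps)
  also have "\<dots> = m + w * \<Phi> ((t - \<mu> c) / \<sigma>\<^sub>v)"
    using posterior_sd_pos by (simp add: integrable_indicator_mult integral_normal_density_atMost)
  finally show ?thesis .
qed

text \<open>
  Neyman--Pearson: a reward paid at quality \<open>v\<close> costs in proportion to the prior density times the
  purchase probability and attracts the indifferent consumer in proportion to the posterior density
  at \<open>c\<close>. The quotient is proportional to \<open>mills_ratio ((v - c) / s\<^sub>\<epsilon>)\<close>, which increases in \<open>v\<close>,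
  so rewards are cheapest at low qualities.
\<close>

lemma threshold_dominates:
  assumes [measurable]: "r \<in> borel_measurable borel" and r: "\<And>v. m \<le> r v" "\<And>v. r v \<le> m + w"
    and expect: "(\<integral>v. r v \<partial>posterior \<theta> s\<^sub>\<theta> s\<^sub>\<epsilon> c) = m + w * \<Phi> ((t - \<mu> c) / \<sigma>\<^sub>v)"
  defines "thr \<equiv> \<lambda>v. m + threshold_program w t v"
  shows "profit \<theta> s\<^sub>\<theta> s\<^sub>\<epsilon> p r c \<le> profit \<theta> s\<^sub>\<theta> s\<^sub>\<epsilon> p thr c"
    and "profit \<theta> s\<^sub>\<theta> s\<^sub>\<epsilon> p r c = profit \<theta> s\<^sub>\<theta> s\<^sub>\<epsilon> p thr c \<Longrightarrow> AE v in lborel. r v = thr v"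
proof -
  define B where "B = \<bar>m\<bar> + w"
  have rB: "\<bar>r v\<bar> \<le> B" for v using r[of v] reward_pos by (auto simp: B_def)
  have thrB: "\<bar>thr v\<bar> \<le> B" for v
    using reward_pos by (auto simp: thr_def threshold_program_def B_def split: split_indicator)
  have [measurable]: "thr \<in> borel_measurable borel"
    unfolding thr_def threshold_program_def by measurable
  define h where "h = (\<lambda>v. mills_ratio ((v - c) / s\<^sub>\<epsilon>))"
  define \<pi> where "\<pi> = normal_density \<theta> s\<^sub>\<theta>"
  define post where "post = normal_density (\<mu> c) \<sigma>\<^sub>v"
  \<comment> \<open>\<open>h t\<close> acts as a Lagrange multiplier for the indifference condition:
    both programs have the same posterior mean, so the term with \<open>h t\<close> integrates to
    zero and the integral of \<open>gap\<close> is the difference of the profits.\<close>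
  define gap where "gap = (\<lambda>v. (thr v - r v) * (h t - h v) * (\<phi> ((v - c) / s\<^sub>\<epsilon>) * \<pi> v))"
  have \<pi>_pos: "\<pi> v > 0" for v using prior_sd_pos by (simp add: \<pi>_def normal_density_pos)
  have dens: "\<phi> ((v - c) / s\<^sub>\<epsilon>) * \<pi> v = s\<^sub>\<epsilon> * d c * post v" for v
  proof -
    have "normal_density v s\<^sub>\<epsilon> c = \<phi> ((v - c) / s\<^sub>\<epsilon>) / s\<^sub>\<epsilon>"
      unfolding normal_density_swap[of v] by (rule normal_density_std[OF noise_sd_pos])
    then have "\<phi> ((v - c) / s\<^sub>\<epsilon>) * \<pi> v =
        s\<^sub>\<epsilon> * (normal_density \<theta> s\<^sub>\<theta> v * normal_density v s\<^sub>\<epsilon> c)"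
      using noise_sd_pos by (simp add: \<pi>_def)
    then show ?thesis unfolding joint_density by (simp add: post_def)
  qed
  have gap_eq: "gap v = (h t * (s\<^sub>\<epsilon> * d c)) * (thr v * post v - r v * post v) -
      (thr v * (\<Phi> ((v - c) / s\<^sub>\<epsilon>) * \<pi> v) - r v * (\<Phi> ((v - c) / s\<^sub>\<epsilon>) * \<pi> v))" for v
  proof -
    have "gap v = (thr v - r v) * (h t * (\<phi> ((v - c) / s\<^sub>\<epsilon>) * \<pi> v) - \<Phi> ((v - c) / s\<^sub>\<epsilon>) * \<pi> v)"
      unfolding gap_def h_def mills_ratio_mult_pdf[of "(v - c) / s\<^sub>\<epsilon>", symmetric]
      by (simp add: algebra_simps)
    then show ?thesis by (simp only: dens) (simp add: algebra_simps)
  qed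
  have "integrable lborel post" using posterior_sd_pos by (simp add: post_def)
  note int_post = integrable_bounded_mult[OF _ this rB] integrable_bounded_mult[OF _ this thrB]
  have "integrable lborel (\<lambda>v. \<Phi> ((v - c) / s\<^sub>\<epsilon>) * \<pi> v)"
    unfolding \<pi>_def by (rule integrable_sales)
  note int_sales = integrable_bounded_mult[OF _ this rB] integrable_bounded_mult[OF _ this thrB]
  have int_gap: "integrable lborel gap"
    unfolding gap_eq[abs_def] using int_post int_sales by simp
  have "(\<integral>v. thr v * post v \<partial>lborel) = (\<integral>v. r v * post v \<partial>lborel)"
    using posterior_integral_threshold[where m=m and t=t and c=c] expect
    by (simp add: posterior_integral post_def thr_def[symmetric])
  then have gap_integral: "(\<integral>v. gap v \<partial>lborel) = profit \<theta> s\<^sub>\<theta> s\<^sub>\<epsilon> p thr c - profit \<theta> s\<^sub>\<theta> s\<^sub>\<epsilon> p r c"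
    unfolding gap_eq using int_post int_sales
    by (simp add: profit_eq[OF _ rB] profit_eq[OF _ thrB] \<pi>_def[symmetric])
  have h_mono: "h x < h y" if "x < y" for x y
    using that noise_sd_pos unfolding h_def
    by (intro mills_ratio_strict_mono divide_strict_right_mono) auto
  have sign: "0 \<le> (thr v - r v) * (h t - h v)" for v
  proof (cases "v \<le> t")
    case True
    then have "h v \<le> h t" using h_mono[of v t] by (cases "v = t") auto
    then show ?thesis
      using r(2)[of v] True by (intro mult_nonneg_nonneg) (auto simp: thr_def threshold_program_def)
  next
    case False
    then show ?thesis
      using r(1)[of v] h_mono[of t v] by (intro mult_nonpos_nonpos) (auto simp: thr_def threshold_program_def)
  qed
  have gap_nonneg: "0 \<le> gap v" for v
    unfolding gap_def using \<pi>_pos[of v] by (intro mult_nonneg_nonneg[OF sign]) auto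
  then have "0 \<le> (\<integral>v. gap v \<partial>lborel)" by (intro Bochner_Integration.integral_nonneg)
  then show "profit \<theta> s\<^sub>\<theta> s\<^sub>\<epsilon> p r c \<le> profit \<theta> s\<^sub>\<theta> s\<^sub>\<epsilon> p thr c"
    by (simp add: gap_integral)
  assume "profit \<theta> s\<^sub>\<theta> s\<^sub>\<epsilon> p r c = profit \<theta> s\<^sub>\<theta> s\<^sub>\<epsilon> p thr c"
  then have "AE v in lborel. gap v = 0"
    using integral_nonneg_eq_0_iff_AE[OF int_gap] gap_nonneg by (simp add: gap_integral)
  \<comment> \<open>As \<open>h\<close> is strictly increasing, \<open>h t - h v\<close> vanishes
    only at \<open>v = t\<close>, so a zero gap forces the programs to agree elsewhere.\<close>
  with AE_lborel_singleton[of t] show "AE v in lborel. r v = thr v"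
  proof eventually_elim
    case (elim v)
    then have "h t \<noteq> h v" using h_mono[of t v] h_mono[of v t] by (cases v t rule: linorder_cases) auto
    then show ?case using elim(2) \<pi>_pos[of v] by (simp add: gap_def)
  qed
qed

text \<open>A function on one side of its mean has zero mean absolute deviation. The posterior
  density is positive everywhere, so its null sets are those of Lebesgue measure.\<close>

lemma AE_eq_if_posterior_integral_extreme:
  fixes r :: "real \<Rightarrow> real"
  assumes [measurable]: "r \<in> borel_measurable borel" and bound: "\<And>v. \<bar>r v\<bar> \<le> B"
    and side: "(\<forall>v. k \<le> r v) \<or> (\<forall>v. r v \<le> k)"
    and expect: "(\<integral>v. r v \<partial>posterior \<theta> s\<^sub>\<theta> s\<^sub>\<epsilon> c) = k"
  shows "AE v in lborel. r v = k"
proof -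
  define post where "post = normal_density (\<mu> c) \<sigma>\<^sub>v"
  have post_pos: "post v > 0" for v using posterior_sd_pos by (simp add: post_def normal_density_pos)
  have int_post: "integrable lborel post" using posterior_sd_pos by (simp add: post_def)
  have int: "integrable lborel (\<lambda>v. \<bar>r v - k\<bar> * post v)"
    using bound by (intro integrable_bounded_mult[where B="B + \<bar>k\<bar>", OF _ int_post])
      (auto intro: order_trans[OF abs_triangle_ineq4] add_right_mono)
  have "(\<integral>v. (r v - k) * post v \<partial>lborel) = 0"
    using integrable_bounded_mult[OF assms(1) int_post bound] int_post expect posterior_sd_pos
    by (simp add: posterior_integral left_diff_distrib) (simp add: post_def)
  moreover have "(\<lambda>v. \<bar>r v - k\<bar> * post v) = (\<lambda>v. (r v - k) * post v) \<or>
      (\<lambda>v. \<bar>r v - k\<bar> * post v) = (\<lambda>v. - ((r v - k) * post v))"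
    using side
  proof
    assume "\<forall>v. k \<le> r v"
    then have "\<bar>r v - k\<bar> = r v - k" for v by simp
    then show ?thesis by simp
  next
    assume "\<forall>v. r v \<le> k"
    then have "\<bar>r v - k\<bar> = - (r v - k)" for v by simp
    then show ?thesis by (intro disjI2) (simp only: mult_minus_left)
  qed
  ultimately have "(\<integral>v. \<bar>r v - k\<bar> * post v \<partial>lborel) = 0" by auto
  then have "AE v in lborel. \<bar>r v - k\<bar> * post v = 0"
    using integral_nonneg_eq_0_iff_AE[OF int] post_pos by (simp add: less_imp_le)
  then show ?thesis
    using post_pos by (auto elim!: eventually_mono) (metis less_irrefl)
qed

text \<open>The first alternative covers programs that are constant almost everywhere. Otherwise the
  program is replaced by a threshold program with the same cutoff, and the effective price is then
  raised to \<open>p\<close>. The clause on equality yields the form of every optimal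
  program.\<close>

lemma feasible_dominated:
  assumes feasible: "SC_feasible \<theta> s\<^sub>\<theta> s\<^sub>\<epsilon> p r c"
  shows "profit \<theta> s\<^sub>\<theta> s\<^sub>\<epsilon> p r c \<le> p * D p \<or>
    (\<exists>z. profit \<theta> s\<^sub>\<theta> s\<^sub>\<epsilon> p r c \<le> K p z \<and>
      (profit \<theta> s\<^sub>\<theta> s\<^sub>\<epsilon> p r c = K p z \<longrightarrow> c = cutoff p z \<and>
        (AE v in lborel. r v = threshold_program w (threshold p z) v)))"
proof -
  have meas [measurable]: "r \<in> borel_measurable borel" and r: "\<And>v. 0 \<le> r v" "\<And>v. r v \<le> p"
    and spread: "spread r \<le> spread_bound s\<^sub>\<theta> s\<^sub>\<epsilon>"
    and indiff: "c + (\<integral>v. r v \<partial>posterior \<theta> s\<^sub>\<theta> s\<^sub>\<epsilon> c) = p"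
    using feasible by (auto simp: SC_feasible_def reward_program_def)
  have bound: "\<bar>r v\<bar> \<le> p" for v using r[of v] by auto
  \<comment> \<open>If \<open>w = p\<close>, the range constraint suffices with
    \<open>m = 0\<close>. Otherwise \<open>w\<close> is the spread bound and the infimum of
    \<open>r\<close> serves.\<close>
  obtain m where m: "0 \<le> m" "\<And>v. m \<le> r v" "\<And>v. r v \<le> m + w"
  proof (cases "w = p")
    case True
    then show thesis using r by (intro that[of 0]) auto
  next
    case False
    then have w: "w = spread_bound s\<^sub>\<theta> s\<^sub>\<epsilon>" by (auto simp: SC_reward_def min_def split: if_splits)
    have "(INF v. r v) \<le> r v" "r v \<le> (SUP v. r v)" for v
      using r by (auto intro!: cINF_lower cSUP_upper bdd_belowI2 bdd_aboveI2)
    moreover from this have "r v \<le> (INF v. r v) + w" for v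
      using spread by (simp add: spread_def w) (smt (verit, best))
    moreover have "0 \<le> (INF v. r v)" using r by (intro cINF_greatest) auto
    ultimately show thesis by (intro that[of "INF v. r v"])
  qed
  define e where "e = (\<integral>v. r v \<partial>posterior \<theta> s\<^sub>\<theta> s\<^sub>\<epsilon> c)"
  define post where "post = normal_density (\<mu> c) \<sigma>\<^sub>v"
  have post: "integrable lborel post" "(\<integral>v. post v \<partial>lborel) = 1"
    using posterior_sd_pos by (simp_all add: post_def)
  have post_nonneg: "0 \<le> post v" for v by (simp add: post_def)
  have e_eq: "e = (\<integral>v. r v * post v \<partial>lborel)"
    by (simp add: e_def post_def posterior_integral)
  have lower: "k \<le> e" if "\<And>v. k \<le> r v" for k
  proof -
    have "(\<integral>v. k * post v \<partial>lborel) \<le> e"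
      unfolding e_eq using that post_nonneg
      by (intro integral_mono integrable_mult_right post(1) integrable_bounded_mult[OF meas post(1) bound]
          mult_right_mono)
    then show ?thesis by (simp add: post)
  qed
  have upper: "e \<le> k" if "\<And>v. r v \<le> k" for k
  proof -
    have "e \<le> (\<integral>v. k * post v \<partial>lborel)"
      unfolding e_eq using that post_nonneg
      by (intro integral_mono integrable_mult_right post(1) integrable_bounded_mult[OF meas post(1) bound]
          mult_right_mono)
    then show ?thesis by (simp add: post)
  qed
  have c: "c = p - e" using indiff by (simp add: e_def)
  \<comment> \<open>A constant reward \<open>e\<close> amounts to selling at the price
    \<open>p - e\<close>, which cannot beat the optimal price.\<close>
  have extreme: "profit \<theta> s\<^sub>\<theta> s\<^sub>\<epsilon> p r c \<le> p * D p" if "(\<forall>v. e \<le> r v) \<or> (\<forall>v. r v \<le> e)"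
  proof -
    have "AE v in lborel. r v = e"
      using AE_eq_if_posterior_integral_extreme[OF meas bound that] by (simp add: e_def)
    from profit_AE_const[OF meas bound this] show ?thesis
      using price_max[of c] by (simp add: c)
  qed
  consider "e = m" | "e = m + w" | "m < e" "e < m + w"
    using lower[OF m(2)] upper[OF m(3)] by linarith
  then show ?thesis
  proof cases
    case 1
    then show ?thesis using extreme m by auto
  next
    case 2
    then show ?thesis using extreme m by auto
  next
    case 3
    \<comment> \<open>With this posterior quantile, \<open>m\<close> plus the threshold program has
      the posterior mean \<open>e\<close>, which keeps \<open>c\<close> as the indifferent
      valuation.\<close>
    then obtain z where "\<Phi> z = (e - m) / w"
      using std_cdf_surj[of "(e - m) / w"] reward_pos by auto
    then have z: "w * \<Phi> z = e - m" using reward_pos by simp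
    have cut: "c = cutoff (p - m) z" by (simp add: cutoff_def z c)
    define t where "t = threshold (p - m) z"
    have t: "(t - \<mu> c) / \<sigma>\<^sub>v = z" unfolding t_def cut by (rule threshold_normalised)
    have expect: "(\<integral>v. r v \<partial>posterior \<theta> s\<^sub>\<theta> s\<^sub>\<epsilon> c) = m + w * \<Phi> ((t - \<mu> c) / \<sigma>\<^sub>v)"
      unfolding t z by (simp add: e_def)
    note dom = threshold_dominates[OF meas m(2,3) expect]
    have thr: "profit \<theta> s\<^sub>\<theta> s\<^sub>\<epsilon> p (\<lambda>v. m + threshold_program w t v) c = K (p - m) z"
      unfolding profit_threshold K_def cut t_def ..
    show ?thesis
    proof (cases "m = 0")
      case True
      then show ?thesis using dom thr cut t_def by auto
    next
      case False
      \<comment> \<open>For positive \<open>m\<close> the effective price \<open>p - m\<close> is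
        below \<open>p\<close>, and the nonnegative cutoff meets the remaining condition of
        \<open>K_price_less\<close>; such a program is strictly worse.\<close>
      have "0 \<le> c" using upper[OF r(2)] c by simp
      then have "K (p - m) z < K p z"
        using False m(1) by (intro K_price_less) (auto simp: cut)
      then have "profit \<theta> s\<^sub>\<theta> s\<^sub>\<epsilon> p r c < K p z" using dom(1) thr by simp
      then show ?thesis by (intro disjI2 exI[of _ z]) auto
    qed
  qed
qed

lemma threshold_feasible:
  "SC_feasible \<theta> s\<^sub>\<theta> s\<^sub>\<epsilon> p (threshold_program w (threshold p z)) (cutoff p z)"
proof -
  let ?r = "threshold_program w (threshold p z)"
  have r: "0 \<le> ?r v" "?r v \<le> w" for v
    using reward_pos by (auto simp: threshold_program_def split: split_indicator)
  have "reward_program p ?r"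
    unfolding reward_program_def using r order_trans[OF r(2) reward_le_price]
    by (auto simp: threshold_program_def[abs_def])
  moreover have "spread ?r \<le> w - 0"
    unfolding spread_def using r by (intro diff_mono cSUP_least cINF_greatest) auto
  moreover have "(\<integral>v. ?r v \<partial>posterior \<theta> s\<^sub>\<theta> s\<^sub>\<epsilon> (cutoff p z)) = w * \<Phi> z"
    using posterior_integral_threshold[where m=0 and t="threshold p z" and c="cutoff p z"]
    by (simp add: threshold_normalised)
  ultimately show ?thesis
    using reward_le_spread_bound by (simp add: SC_feasible_def cutoff_def)
qed

lemma profit_threshold_feasible:
  "profit \<theta> s\<^sub>\<theta> s\<^sub>\<epsilon> p (threshold_program w (threshold p z)) (cutoff p z) = K p z"
  using profit_threshold[where m=0 and t="threshold p z" and c="cutoff p z"] by (simp add: K_def)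

section \<open>Existence and form of the optimal programs\<close>

lemma SC_optimal_threshold:
  obtains z where "SC_optimal \<theta> s\<^sub>\<theta> s\<^sub>\<epsilon> p (threshold_program w (threshold p z)) (cutoff p z)"
    and "SC_system \<theta> s\<^sub>\<theta> s\<^sub>\<epsilon> p (cutoff p z) (threshold p z)"
proof -
  obtain z where z: "\<And>y. K p y \<le> K p z" "p * D p < K p z" using K_max by blast
  have "profit \<theta> s\<^sub>\<theta> s\<^sub>\<epsilon> p r c \<le> K p z" if "SC_feasible \<theta> s\<^sub>\<theta> s\<^sub>\<epsilon> p r c" for r c
    using feasible_dominated[OF that] z(2) order_trans[OF _ z(1)] by force
  then have "SC_optimal \<theta> s\<^sub>\<theta> s\<^sub>\<epsilon> p (threshold_program w (threshold p z)) (cutoff p z)"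
    using threshold_feasible unfolding SC_optimal_def profit_threshold_feasible by blast
  then show thesis using SC_system_if_K_max[OF z(1)] by (rule that)
qed

text \<open>An optimal program earns at least every \<open>K p y\<close>, hence more than
  \<open>p * D p\<close>, so the second alternative of \<open>feasible_dominated\<close> holds. The
  dominating \<open>z\<close> then maximises \<open>K p\<close> and attains equality, which
  identifies the program and yields the system.\<close>

lemma SC_optimal_unique_form:
  assumes "SC_optimal \<theta> s\<^sub>\<theta> s\<^sub>\<epsilon> p r c"
  shows "\<exists>t. SC_system \<theta> s\<^sub>\<theta> s\<^sub>\<epsilon> p c t \<and> (AE v in lborel. r v = threshold_program w t v)"
proof -
  have feasible: "SC_feasible \<theta> s\<^sub>\<theta> s\<^sub>\<epsilon> p r c" and max: "K p y \<le> profit \<theta> s\<^sub>\<theta> s\<^sub>\<epsilon> p r c" for y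
    using assms threshold_feasible[of y] unfolding SC_optimal_def profit_threshold_feasible[of y, symmetric]
    by blast+
  obtain y where "p * D p < K p y" using K_max by blast
  then have "\<not> profit \<theta> s\<^sub>\<theta> s\<^sub>\<epsilon> p r c \<le> p * D p" using max[of y] by linarith
  then obtain z where z: "profit \<theta> s\<^sub>\<theta> s\<^sub>\<epsilon> p r c \<le> K p z"
    and eq: "profit \<theta> s\<^sub>\<theta> s\<^sub>\<epsilon> p r c = K p z \<longrightarrow> c = cutoff p z \<and>
      (AE v in lborel. r v = threshold_program w (threshold p z) v)"
    using feasible_dominated[OF feasible] by blast
  have "K p y \<le> K p z" for y using max[of y] z by linarith
  from SC_system_if_K_max[OF this] show ?thesis using eq max[of z] z by auto
qed

end

theorem theorem3:
  fixes \<theta> s\<^sub>\<theta> s\<^sub>\<epsilon> p :: real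
  assumes "s\<^sub>\<theta> > 0" and "s\<^sub>\<epsilon> > 0"
    and "optimal_price \<theta> s\<^sub>\<theta> s\<^sub>\<epsilon> p"
  shows "(\<exists>r c. SC_optimal \<theta> s\<^sub>\<theta> s\<^sub>\<epsilon> p r c) \<and>
    (\<forall>r c. SC_optimal \<theta> s\<^sub>\<theta> s\<^sub>\<epsilon> p r c \<longrightarrow>
      (\<exists>v\<^sub>c. SC_system \<theta> s\<^sub>\<theta> s\<^sub>\<epsilon> p c v\<^sub>c \<and>
        (AE v in lborel. r v = threshold_program (SC_reward s\<^sub>\<theta> s\<^sub>\<epsilon> p) v\<^sub>c v))) \<and>
    (\<forall>c v\<^sub>c. SC_system \<theta> s\<^sub>\<theta> s\<^sub>\<epsilon> p c v\<^sub>c \<and>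
        (\<forall>c' v'. SC_system \<theta> s\<^sub>\<theta> s\<^sub>\<epsilon> p c' v' \<longrightarrow> c' = c \<and> v' = v\<^sub>c) \<longrightarrow>
      SC_optimal \<theta> s\<^sub>\<theta> s\<^sub>\<epsilon> p (threshold_program (SC_reward s\<^sub>\<theta> s\<^sub>\<epsilon> p) v\<^sub>c) c)"
proof -
  interpret reward_model \<theta> s\<^sub>\<theta> s\<^sub>\<epsilon> p
    using assms by unfold_locales
  obtain z where z: "SC_optimal \<theta> s\<^sub>\<theta> s\<^sub>\<epsilon> p (threshold_program w (threshold p z)) (cutoff p z)"
    "SC_system \<theta> s\<^sub>\<theta> s\<^sub>\<epsilon> p (cutoff p z) (threshold p z)"
    by (rule SC_optimal_threshold)
  show ?thesis
  proof (intro conjI allI impI)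
    show "\<exists>r c. SC_optimal \<theta> s\<^sub>\<theta> s\<^sub>\<epsilon> p r c" using z(1) by blast
  next
    fix r c assume "SC_optimal \<theta> s\<^sub>\<theta> s\<^sub>\<epsilon> p r c"
    then show "\<exists>v\<^sub>c. SC_system \<theta> s\<^sub>\<theta> s\<^sub>\<epsilon> p c v\<^sub>c \<and>
        (AE v in lborel. r v = threshold_program (SC_reward s\<^sub>\<theta> s\<^sub>\<epsilon> p) v\<^sub>c v)"
      by (rule SC_optimal_unique_form)
  next
    fix c v\<^sub>c
    assume "SC_system \<theta> s\<^sub>\<theta> s\<^sub>\<epsilon> p c v\<^sub>c \<and>
      (\<forall>c' v'. SC_system \<theta> s\<^sub>\<theta> s\<^sub>\<epsilon> p c' v' \<longrightarrow> c' = c \<and> v' = v\<^sub>c)"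
    \<comment> \<open>The maximiser constructed above solves the system, so it is the assumed unique
      solution.\<close>
    then have "cutoff p z = c" "threshold p z = v\<^sub>c" using z(2) by blast+
    then show "SC_optimal \<theta> s\<^sub>\<theta> s\<^sub>\<epsilon> p (threshold_program (SC_reward s\<^sub>\<theta> s\<^sub>\<epsilon> p) v\<^sub>c) c"
      using z(1) by simp
  qed
qed

end
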